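(* Let $\emptyset\neq\mathcal{X}\subseteq\{0,1\}^n$, $\hat c\in\mathbb{R}^n_{\ge0}$, $d\in\mathbb{R}^n_{\ge0}$, and $B=\prod_{i=1}^n[-d_i,d_i]$ (variable, i.e. arbitrary, growth). Let $K$ be an upper bound for $|\mathcal{E}_{\min}|$, where $\mathcal{E}_{\min}$ is taken with respect to the bicriteria problem $\min_{x\in\mathcal{X}}(\hat c^tx,\ d^tx)^t$. Then the variable-sized robust problem can be solved in $O(KT)$ time, and the resulting set satisfies $|\mathcal{S}|\le K$.
   Context: For $\lambda\ge0$ let $\mathcal{U}_\lambda=\{\hat c\}+\lambda B$ and consider $\mathsf{P}(\lambda)$: $\min_{x\in\mathcal{X}}\max_{c\in\mathcal{U}_\lambda}c^tx$. Solving the variable-sized robust problem means computing a set $\mathcal{S}\subset\mathcal{X}$ of smallest possible size such that for every $\lambda\ge0$, $\mathcal{S}$ contains an optimal solution of $\mathsf{P}(\lambda)$. $T$ denotes the time necessary to solve the nominal problem $\min\{c^tx:x\in\mathcal{X}\}$ for a given nonnegative cost vector $c$. Let $F(x)=(\hat c^tx,d^tx)^t$ and $\mathcal{V}=\operatorname{conv}(\{F(x):x\in\mathcal{X}\})+\mathbb{R}^2_+$. A solution $x\in\mathcal{X}$ is an efficient extreme solution if $F(x)$ is a vertex of $\mathcal{V}$. Two solutions $x\ne x'$ are equivalent if $F(x)=F(x')$. $\mathcal{E}_{\min}$ is a maximal subset of the set of efficient extreme solutions containing no two equivalent solutions. *)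

theory Defs
  imports "HOL-Analysis.Analysis"
begin

section \<open>The variable-sized robust problem\<close>

text \<open>
  The dimension \<open>n\<close> is an input of the algorithm below, hence a variable of the statement and not a
  type. A vector of \<open>\<real>\<^sup>n\<close> is a function on \<open>{..<n}\<close>, extended by \<open>undefined\<close>
  (an element of \<open>{..<n} \<rightarrow>\<^sub>E UNIV\<close>), so that equality of vectors and cardinalities are the usual ones.
\<close>

type_synonym vect = "nat \<Rightarrow> real"

definition dotp :: "nat \<Rightarrow> vect \<Rightarrow> vect \<Rightarrow> real" where
  "dotp n c x = (\<Sum>i<n. c i * x i)"

definition box_set :: "nat \<Rightarrow> vect \<Rightarrow> vect set" where
  "box_set n d = (\<Pi>\<^sub>E i\<in>{..<n}. {- d i..d i})"

definition uncertainty_set :: "nat \<Rightarrow> vect \<Rightarrow> vect set \<Rightarrow> real \<Rightarrow> vect set" where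
  "uncertainty_set n chat B lam = {(\<lambda>i\<in>{..<n}. chat i + lam * b i) | b. b \<in> B}"

text \<open>For the compact nonempty sets \<open>U\<close> in question the supremum is the maximum over \<open>U\<close>.\<close>

definition worst_case :: "nat \<Rightarrow> vect set \<Rightarrow> vect \<Rightarrow> real" where
  "worst_case n U x = (SUP c\<in>U. dotp n c x)"

definition robust_optimal :: "nat \<Rightarrow> vect set \<Rightarrow> vect \<Rightarrow> vect set \<Rightarrow> real \<Rightarrow> vect \<Rightarrow> bool" where
  "robust_optimal n X chat B lam x \<longleftrightarrow>
     is_arg_min (worst_case n (uncertainty_set n chat B lam)) (\<lambda>y. y \<in> X) x"

definition covers_all_sizes :: "nat \<Rightarrow> vect set \<Rightarrow> vect \<Rightarrow> vect set \<Rightarrow> vect set \<Rightarrow> bool" where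
  "covers_all_sizes n X chat B S \<longleftrightarrow>
     S \<subseteq> X \<and> (\<forall>lam\<ge>0. \<exists>x\<in>S. robust_optimal n X chat B lam x)"

definition variable_sized_solution :: "nat \<Rightarrow> vect set \<Rightarrow> vect \<Rightarrow> vect set \<Rightarrow> vect set \<Rightarrow> bool" where
  "variable_sized_solution n X chat B S \<longleftrightarrow>
     covers_all_sizes n X chat B S \<and>
     (\<forall>S'. covers_all_sizes n X chat B S' \<longrightarrow> card S \<le> card S')"

section \<open>The bicriteria problem\<close>

definition biobj :: "nat \<Rightarrow> vect \<Rightarrow> vect \<Rightarrow> vect \<Rightarrow> real \<times> real" where
  "biobj n chat d x = (dotp n chat x, dotp n d x)"

definition upper_image :: "nat \<Rightarrow> vect set \<Rightarrow> vect \<Rightarrow> vect \<Rightarrow> (real \<times> real) set" where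
  "upper_image n X chat d =
     {v + r | v r. v \<in> convex hull (biobj n chat d ` X) \<and> r \<in> {0..} \<times> {0..}}"

definition efficient_extreme :: "nat \<Rightarrow> vect set \<Rightarrow> vect \<Rightarrow> vect \<Rightarrow> vect set" where
  "efficient_extreme n X chat d =
     {x \<in> X. biobj n chat d x extreme_point_of upper_image n X chat d}"

definition no_equivalent_pair :: "nat \<Rightarrow> vect \<Rightarrow> vect \<Rightarrow> vect set \<Rightarrow> bool" where
  "no_equivalent_pair n chat d E \<longleftrightarrow>
     (\<forall>x\<in>E. \<forall>x'\<in>E. x \<noteq> x' \<longrightarrow> biobj n chat d x \<noteq> biobj n chat d x')"

definition is_E_min :: "nat \<Rightarrow> vect set \<Rightarrow> vect \<Rightarrow> vect \<Rightarrow> vect set \<Rightarrow> bool" where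
  "is_E_min n X chat d E \<longleftrightarrow>
     E \<subseteq> efficient_extreme n X chat d \<and> no_equivalent_pair n chat d E \<and>
     (\<forall>E'. E \<subseteq> E' \<and> E' \<subseteq> efficient_extreme n X chat d \<and> no_equivalent_pair n chat d E' \<longrightarrow> E' = E)"

section \<open>Model of computation\<close>

text \<open>
  Running times are those of a real RAM, given as a structured language: natural-number registers
  with addition and truncated subtraction (for counting and addressing), arrays of exact reals with
  the field operations, and comparisons, each at unit cost. The feasible set is accessible only
  through \<open>Query\<close>, a call of the solver of the nominal problem, which costs \<open>T\<close>. As a step writes
  at most one cell, a solver needs at least \<open>n\<close> steps to write a solution; hence the hypothesis
  \<open>n \<le> T\<close> made on \<open>T\<close>.
  Registers and arrays have fixed names (numbers) in the program text; only array indices are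
  computed.
\<close>

datatype iexp = INum nat | IReg nat | IAdd iexp iexp | ISub iexp iexp

datatype rexp =
    RNum nat | RCell nat iexp
  | RAdd rexp rexp | RSub rexp rexp | RMul rexp rexp | RDiv rexp rexp

datatype bexp = ILess iexp iexp | RLess rexp rexp | BNot bexp | BAnd bexp bexp

text \<open>
  \<open>Query a e b f\<close> passes the \<open>n\<close> cells of array \<open>a\<close> from index \<open>e\<close> on as a cost vector and writes the
  solution returned into the \<open>n\<close> cells of array \<open>b\<close> from index \<open>f\<close> on.
\<close>

datatype com =
    Skip
  | ISet nat iexp
  | RSet nat iexp rexp
  | Query nat iexp nat iexp
  | Seq com com
  | Cond bexp com com
  | While bexp com

type_synonym regs = "nat \<Rightarrow> nat"
type_synonym arrays = "nat \<Rightarrow> nat \<Rightarrow> real"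
type_synonym state = "regs \<times> arrays"

fun ival :: "state \<Rightarrow> iexp \<Rightarrow> nat" where
  "ival s (INum k) = k"
| "ival s (IReg v) = fst s v"
| "ival s (IAdd e f) = ival s e + ival s f"
| "ival s (ISub e f) = ival s e - ival s f"

fun rval :: "state \<Rightarrow> rexp \<Rightarrow> real" where
  "rval s (RNum k) = real k"
| "rval s (RCell a e) = snd s a (ival s e)"
| "rval s (RAdd p q) = rval s p + rval s q"
| "rval s (RSub p q) = rval s p - rval s q"
| "rval s (RMul p q) = rval s p * rval s q"
| "rval s (RDiv p q) = rval s p / rval s q"

fun bval :: "state \<Rightarrow> bexp \<Rightarrow> bool" where
  "bval s (ILess e f) \<longleftrightarrow> ival s e < ival s f"
| "bval s (RLess p q) \<longleftrightarrow> rval s p < rval s q"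
| "bval s (BNot b) \<longleftrightarrow> \<not> bval s b"
| "bval s (BAnd b b') \<longleftrightarrow> bval s b \<and> bval s b'"

fun icost :: "iexp \<Rightarrow> nat" where
  "icost (INum k) = 1"
| "icost (IReg v) = 1"
| "icost (IAdd e f) = 1 + icost e + icost f"
| "icost (ISub e f) = 1 + icost e + icost f"

fun rcost :: "rexp \<Rightarrow> nat" where
  "rcost (RNum k) = 1"
| "rcost (RCell a e) = 1 + icost e"
| "rcost (RAdd p q) = 1 + rcost p + rcost q"
| "rcost (RSub p q) = 1 + rcost p + rcost q"
| "rcost (RMul p q) = 1 + rcost p + rcost q"
| "rcost (RDiv p q) = 1 + rcost p + rcost q"

fun bcost :: "bexp \<Rightarrow> nat" where
  "bcost (ILess e f) = 1 + icost e + icost f"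
| "bcost (RLess p q) = 1 + rcost p + rcost q"
| "bcost (BNot b) = 1 + bcost b"
| "bcost (BAnd b b') = 1 + bcost b + bcost b'"

definition set_reg :: "nat \<Rightarrow> nat \<Rightarrow> state \<Rightarrow> state" where
  "set_reg v k s = ((fst s)(v := k), snd s)"

definition set_cell :: "nat \<Rightarrow> nat \<Rightarrow> real \<Rightarrow> state \<Rightarrow> state" where
  "set_cell a i r s = (fst s, (snd s)(a := (snd s a)(i := r)))"

definition read_block :: "nat \<Rightarrow> nat \<Rightarrow> nat \<Rightarrow> state \<Rightarrow> vect" where
  "read_block n a i s = (\<lambda>k\<in>{..<n}. snd s a (i + k))"

definition write_block :: "nat \<Rightarrow> nat \<Rightarrow> nat \<Rightarrow> vect \<Rightarrow> state \<Rightarrow> state" where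
  "write_block n a i x s =
     (fst s, (snd s)(a := (\<lambda>k. if i \<le> k \<and> k < i + n then x (k - i) else snd s a k)))"

text \<open>
  \<open>exec n orc T P s t s'\<close>: with the nominal solver \<open>orc\<close>, program \<open>P\<close> started in \<open>s\<close> halts in \<open>s'\<close>
  after time \<open>t\<close>.
\<close>

inductive exec :: "nat \<Rightarrow> (vect \<Rightarrow> vect) \<Rightarrow> nat \<Rightarrow> com \<Rightarrow> state \<Rightarrow> nat \<Rightarrow> state \<Rightarrow> bool"
  for n :: nat and orc :: "vect \<Rightarrow> vect" and T :: nat where
  Skip: "exec n orc T Skip s 1 s"
| ISet: "exec n orc T (ISet v e) s (1 + icost e) (set_reg v (ival s e) s)"
| RSet: "exec n orc T (RSet a e p) s (1 + icost e + rcost p) (set_cell a (ival s e) (rval s p) s)"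
| Query: "exec n orc T (Query a e b f) s (T + icost e + icost f)
            (write_block n b (ival s f) (orc (read_block n a (ival s e) s)) s)"
| Seq: "exec n orc T P s t s' \<Longrightarrow> exec n orc T Q s' t' s'' \<Longrightarrow> exec n orc T (Seq P Q) s (t + t') s''"
| CondTrue: "bval s b \<Longrightarrow> exec n orc T P s t s' \<Longrightarrow>
     exec n orc T (Cond b P Q) s (1 + bcost b + t) s'"
| CondFalse: "\<not> bval s b \<Longrightarrow> exec n orc T Q s t s' \<Longrightarrow>
     exec n orc T (Cond b P Q) s (1 + bcost b + t) s'"
| WhileTrue: "bval s b \<Longrightarrow> exec n orc T P s t s' \<Longrightarrow> exec n orc T (While b P) s' t' s'' \<Longrightarrow>
     exec n orc T (While b P) s (1 + bcost b + t + t') s''"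
| WhileFalse: "\<not> bval s b \<Longrightarrow> exec n orc T (While b P) s (1 + bcost b) s"

text \<open>Nothing is assumed about the answer to a cost vector with a negative entry.\<close>

definition nominal_solver :: "nat \<Rightarrow> vect set \<Rightarrow> (vect \<Rightarrow> vect) \<Rightarrow> bool" where
  "nominal_solver n X orc \<longleftrightarrow>
     (\<forall>c \<in> {..<n} \<rightarrow>\<^sub>E {0..}. is_arg_min (dotp n c) (\<lambda>x. x \<in> X) (orc c))"

text \<open>All registers and cells not holding the input have arbitrary initial contents.\<close>

definition holds_input :: "nat \<Rightarrow> vect \<Rightarrow> vect \<Rightarrow> state \<Rightarrow> bool" where
  "holds_input n chat d s \<longleftrightarrow>
     fst s 0 = n \<and> (\<forall>i<n. snd s 0 i = chat i) \<and> (\<forall>i<n. snd s 1 i = d i)"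

text \<open>
  The output is a list without repetitions: register 1 holds its length, and array 2 holds its
  members one after the other.
\<close>

definition holds_output :: "nat \<Rightarrow> vect set \<Rightarrow> state \<Rightarrow> bool" where
  "holds_output n S s \<longleftrightarrow> bij_betw (\<lambda>k. read_block n 2 (k * n) s) {..<fst s 1} S"

end

theory Submission
  imports Defs
begin

text \<open>
  As the worst case over \<open>U\<^sub>l\<close> of a \<open>0/1\<close> vector \<open>x\<close> is \<open>f x + l * g x\<close> with \<open>f x = c x\<close>, \<open>g x = d x\<close>, the
  robust problem is the parametric weighted sum problem of the two objectives. Every vertex of the
  upper image is the only optimal image for some weight, so a smallest cover consists of one solution
  per vertex.

  The program is a dichotomic search. Between two known supported points it queries the weight
  for which they tie; either a strictly better point is found and put on a stack, or the segment is
  part of the boundary and the search moves on to its right end. The left end is kept only if the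
  weight has increased strictly, which discards weakly efficient points and points inside edges.
  The search stops at the first point with the least second objective. At most two successful
  queries share the upper left vertex of their optimal face, so there are at most
  \<open>2 * card E\<close> of them, and each unsuccessful query removes a point from the stack.
\<close>

section \<open>Weighted sums of two objectives\<close>

text \<open>The weight stands on \<open>g\<close> alone, so that \<open>l\<close> can later be the
  size \<open>lam\<close> of the uncertainty set. Minimising \<open>g\<close> alone is only a limit
  case of large weights and is treated separately.\<close>

definition wopt :: "'a set \<Rightarrow> ('a \<Rightarrow> real) \<Rightarrow> ('a \<Rightarrow> real) \<Rightarrow> real \<Rightarrow> 'a \<Rightarrow> bool" where
  "wopt X f g l x \<longleftrightarrow> x \<in> X \<and> (\<forall>y\<in>X. f x + l * g x \<le> f y + l * g y)"

lemma woptD: "wopt X f g l x \<Longrightarrow> y \<in> X \<Longrightarrow> f x + l * g x \<le> f y + l * g y"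
  by (simp add: wopt_def)

lemma wopt_in: "wopt X f g l x \<Longrightarrow> x \<in> X"
  by (simp add: wopt_def)

text \<open>Adding the two optimality inequalities cancels \<open>f\<close> and leaves a product of
  differences in the weights and in \<open>g\<close>.\<close>

lemma wopt_mono:
  assumes "wopt X f g l x" "wopt X f g l' y" "l < l'"
  shows "g y \<le> g x"
proof -
  have "(l' - l) * (g y - g x) \<le> 0"
    using woptD[OF assms(1) wopt_in[OF assms(2)]] woptD[OF assms(2) wopt_in[OF assms(1)]]
    by (simp add: algebra_simps)
  then show ?thesis
    using assms(3) by (simp add: mult_le_0_iff)
qed

text \<open>The advantage of \<open>x\<close> over \<open>y\<close> is affine in the weight, hence
  smallest at an end of the interval; the sign of \<open>g y - g x\<close> tells which end.\<close>

lemma wopt_between: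
  assumes "wopt X f g l x" "wopt X f g l' x" "l \<le> t" "t \<le> l'"
  shows "wopt X f g t x"
  unfolding wopt_def
proof (intro conjI ballI)
  show "x \<in> X" using assms(1) by (rule wopt_in)
  fix y assume y: "y \<in> X"
  show "f x + t * g x \<le> f y + t * g y"
  proof (cases "g x \<le> g y")
    case True
    have "0 \<le> (t - l) * (g y - g x)" using True assms(3) by simp
    then show ?thesis using woptD[OF assms(1) y] by (simp add: algebra_simps)
  next
    case False
    then have "0 \<le> (l' - t) * (g x - g y)" using assms(4) by simp
    then show ?thesis using woptD[OF assms(2) y] by (simp add: algebra_simps)
  qed
qed

text \<open>For finite nonempty \<open>X\<close> this describes the images that a positive weight
  exposes as a vertex. They are unavoidable: every cover contains a solution with such an
  image.\<close>

definition pinned :: "'a set \<Rightarrow> ('a \<Rightarrow> real) \<Rightarrow> ('a \<Rightarrow> real) \<Rightarrow> 'a \<Rightarrow> bool" where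
  "pinned X f g x \<longleftrightarrow> (\<exists>l>0. \<forall>y. wopt X f g l y \<longrightarrow> f y = f x \<and> g y = g x)"

text \<open>At the midpoint, \<open>wopt_mono\<close> squeezes \<open>g y\<close> to
  \<open>g x\<close> from both sides; equal weighted sums then give equal \<open>f\<close>.\<close>

lemma pinned_between:
  assumes x: "wopt X f g l x" "wopt X f g l' x" and l: "0 \<le> l" "l < l'"
  shows "pinned X f g x"
  unfolding pinned_def
proof (intro exI conjI allI impI)
  let ?t = "(l + l') / 2"
  show "0 < ?t" using l by simp
  fix y assume y: "wopt X f g ?t y"
  have "g y \<le> g x" using wopt_mono[OF x(1) y] l by simp
  moreover have "g x \<le> g y" using wopt_mono[OF y x(2)] l by simp
  ultimately show g: "g y = g x" by simp
  show "f y = f x"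
    using g woptD[OF y wopt_in[OF x(1)]] woptD[OF x(1) wopt_in[OF y]] by simp
qed

lemma wopt_above:
  assumes x: "wopt X f g l x" and g: "\<And>y. y \<in> X \<Longrightarrow> g x \<le> g y" and "l \<le> l'"
  shows "wopt X f g l' x"
  unfolding wopt_def
proof (intro conjI ballI)
  show "x \<in> X" using x by (rule wopt_in)
  fix y assume y: "y \<in> X"
  have "0 \<le> (l' - l) * (g y - g x)" using g[OF y] assms(3) by simp
  then show "f x + l' * g x \<le> f y + l' * g y"
    using woptD[OF x y] by (simp add: algebra_simps)
qed

text \<open>At the weight that pins \<open>x\<close>, whatever \<open>S'\<close> offers has the same
  \<open>g\<close> as \<open>x\<close>. This serves twice: to show that the output is smallest, and
  to bound its size by that of \<open>E\<close>.\<close>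

lemma card_pinned_le:
  assumes S: "\<And>x. x \<in> S \<Longrightarrow> pinned X f g x" and inj: "inj_on g S"
    and S': "finite S'" "\<And>l. 0 < l \<Longrightarrow> \<exists>x\<in>S'. wopt X f g l x"
  shows "card S \<le> card S'"
proof -
  have "g ` S \<subseteq> g ` S'"
  proof
    fix r assume "r \<in> g ` S"
    then obtain x where x: "x \<in> S" "r = g x" by blast
    obtain l where l: "0 < l" "\<forall>y. wopt X f g l y \<longrightarrow> f y = f x \<and> g y = g x"
      using S[OF x(1)] unfolding pinned_def by blast
    obtain y where "y \<in> S'" "wopt X f g l y" using S'(2)[OF l(1)] by blast
    then show "r \<in> g ` S'" using l(2) x(2) by (metis imageI)
  qed
  then have "card (g ` S) \<le> card (g ` S')" using S'(1) by (simp add: card_mono)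
  also have "\<dots> \<le> card S'" using S'(1) by (rule card_image_le)
  finally show ?thesis using card_image[OF inj] by simp
qed

section \<open>Upper left ends of optimal faces and the number of successful queries\<close>

text \<open>These are the upper left ends of the optimal faces.\<close>

definition wopt_max :: "'a set \<Rightarrow> ('a \<Rightarrow> real) \<Rightarrow> ('a \<Rightarrow> real) \<Rightarrow> real \<Rightarrow> 'a \<Rightarrow> bool" where
  "wopt_max X f g l x \<longleftrightarrow> wopt X f g l x \<and> (\<forall>y. wopt X f g l y \<longrightarrow> g y \<le> g x)"

lemma ex_wopt_max:
  assumes "finite X" "X \<noteq> {}"
  shows "\<exists>x. wopt_max X f g l x"
proof -
  let ?O = "{x. wopt X f g l x}"
  obtain x0 where "is_arg_min (\<lambda>x. f x + l * g x) (\<lambda>x. x \<in> X) x0"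
    using ex_is_arg_min_if_finite[OF assms, of "\<lambda>x. f x + l * g x"] by blast
  then have "x0 \<in> ?O" by (auto simp: wopt_def is_arg_min_linorder)
  moreover have "finite ?O"
    by (rule finite_subset[OF _ assms(1)]) (auto simp: wopt_def)
  ultimately have "Max (g ` ?O) \<in> g ` ?O" and "\<And>y. y \<in> ?O \<Longrightarrow> g y \<le> Max (g ` ?O)"
    by (auto intro!: Max_in)
  then show ?thesis unfolding wopt_max_def by (metis imageE mem_Collect_eq)
qed

text \<open>As \<open>e\<close> is still optimal for a larger weight, \<open>wopt_mono\<close>
  leaves no room to the right of \<open>e\<close> on the optimal face at \<open>l\<close>; by its
  choice as the upper left end, there is none to the left either.\<close>

lemma wopt_max_unique:
  assumes "wopt_max X f g l e" "wopt X f g l' e" "l < l'" "wopt X f g l x"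
  shows "f x = f e \<and> g x = g e"
proof -
  have e: "wopt X f g l e" using assms(1) by (simp add: wopt_max_def)
  have "g x \<le> g e" using assms(1,4) by (simp add: wopt_max_def)
  moreover have "g e \<le> g x" using wopt_mono[OF assms(4,2,3)] .
  ultimately show ?thesis
    using woptD[OF e wopt_in[OF assms(4)]] woptD[OF assms(4) wopt_in[OF e]] by simp
qed

lemma wopt_cong:
  assumes "wopt X f g l x" "y \<in> X" "f y = f x" "g y = g x"
  shows "wopt X f g l y"
  using assms by (simp add: wopt_def)

text \<open>
  The pairs stand for successful queries: \<open>p\<close> was returned for the weight \<open>l\<close>. If \<open>e\<close> is the upper
  left end of the optimal face for several of these weights, then for all but the largest of them
  the optimal face is just \<open>e\<close>; this accounts for the factor 2.
\<close>

lemma card_witnesses_le: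
  assumes H: "finite H" "\<And>p l. (p, l) \<in> H \<Longrightarrow> wopt X f g l p"
    and pw: "pairwise (\<lambda>(p, l) (q, m). \<not> (wopt X f g m p \<and> wopt X f g l q)) H"
    and E: "finite E" "\<And>p l. (p, l) \<in> H \<Longrightarrow> \<exists>e\<in>E. wopt_max X f g l e"
  shows "card H \<le> 2 * card E"
proof -
  define e where "e h = (SOME e. e \<in> E \<and> wopt_max X f g (snd h) e)" for h :: "'a \<times> real"
  have e: "e h \<in> E \<and> wopt_max X f g (snd h) (e h)" if "h \<in> H" for h
    unfolding e_def by (rule someI_ex) (use E(2)[of "fst h" "snd h"] that in auto)
  have H': "wopt X f g (snd h) (fst h)" if "h \<in> H" for h
    using H(2)[of "fst h" "snd h"] that by simp
  have fib: "card {h\<in>H. e h = v} \<le> 2" if "v \<in> E" for v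
  proof (cases "{h\<in>H. e h = v} = {}")
    case True
    then show ?thesis by (metis card.empty zero_le)
  next
    case False
    let ?A = "{h\<in>H. e h = v}"
    have fA: "finite ?A" using H(1) by simp
    \<comment> \<open>\<open>M\<close> is a query of largest weight among those whose optimal face
      has the upper left end \<open>v\<close>.\<close>
    have "Max (snd ` ?A) \<in> snd ` ?A" using fA False by (intro Max_in) auto
    then obtain M where M: "Max (snd ` ?A) = snd M" "M \<in> ?A" by (rule imageE)
    have le: "snd h \<le> snd M" if "h \<in> ?A" for h
      unfolding M(1)[symmetric] using fA that by (intro Max_ge) auto
    \<comment> \<open>With equal weights, both answers would be optimal for both weights, against
      \<open>pw\<close>. So the weight of \<open>h\<close> is smaller than that of \<open>M\<close>,
      for which \<open>v\<close> is still optimal, and \<open>wopt_max_unique\<close>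
      applies.\<close>
    have sole: "f (fst h) = f v \<and> g (fst h) = g v" if h: "h \<in> ?A - {M}" for h
    proof -
      have "snd h \<noteq> snd M"
      proof
        assume eq: "snd h = snd M"
        have "wopt X f g (snd M) (fst h)" "wopt X f g (snd h) (fst M)"
          using H'[of h] H'[of M] h M(2) eq by auto
        then show False
          using pairwiseD[OF pw, of h M] h M(2) by (auto simp: case_prod_beta)
      qed
      then have "snd h < snd M" using le[of h] h by auto
      moreover have "wopt_max X f g (snd h) v" "wopt X f g (snd M) v"
        using e[of h] e[of M] h M(2) by (auto simp: wopt_max_def)
      moreover have "wopt X f g (snd h) (fst h)"
        using H'[of h] h by simp
      ultimately show ?thesis using wopt_max_unique by metis
    qed
    \<comment> \<open>Both answers share the image of \<open>v\<close>, which is optimal for both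
      weights; this again contradicts \<open>pw\<close>.\<close>
    have "h = h'" if h: "h \<in> ?A - {M}" "h' \<in> ?A - {M}" for h h'
    proof (rule ccontr)
      assume ne: "h \<noteq> h'"
      have w: "wopt X f g (snd h) v" "wopt X f g (snd h') v"
        using e[of h] e[of h'] h by (auto simp: wopt_max_def)
      have X: "fst h \<in> X" "fst h' \<in> X"
        using H'[of h] H'[of h'] h by (auto simp: wopt_def)
      have "wopt X f g (snd h) (fst h')" "wopt X f g (snd h') (fst h)"
        using wopt_cong[OF w(1) X(2)] wopt_cong[OF w(2) X(1)] sole[OF h(1)] sole[OF h(2)] by auto
      then show False
        using pairwiseD[OF pw, of h h'] h ne by (auto simp: case_prod_beta)
    qed
    then have "card (?A - {M}) \<le> Suc 0"
      using fA by (subst card_le_Suc0_iff_eq) auto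
    then show ?thesis using fA M(2) by (simp add: card_Diff_singleton)
  qed
  have "H = (\<Union>v\<in>E. {h\<in>H. e h = v})" using e by blast
  then have "card H \<le> (\<Sum>v\<in>E. card {h\<in>H. e h = v})"
    using card_UN_le[OF E(1), of "\<lambda>v. {h\<in>H. e h = v}"] by simp
  also have "\<dots> \<le> (\<Sum>v\<in>E. 2)" by (rule sum_mono) (rule fib)
  finally show ?thesis by simp
qed

section \<open>The dichotomic search\<close>

definition stack_le :: "('a \<Rightarrow> real) \<Rightarrow> ('a \<Rightarrow> real) \<Rightarrow> real \<Rightarrow> 'a \<Rightarrow> 'a \<Rightarrow> bool" where
  "stack_le f g m x y \<longleftrightarrow> g y < g x \<or> (g x = m \<and> g y = m \<and> f x \<le> f y)"

text \<open>
  \<open>out\<close> are the points already known to belong to the solution, \<open>L\<close> is the current point and optimal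
  for \<open>mu\<close>, \<open>st\<close> is the stack of pending points to the right of \<open>L\<close>, \<open>m\<close> is the least value of \<open>g\<close>,
  and \<open>H\<close> records the successful queries made so far.
\<close>

definition search_inv ::
  "'a set \<Rightarrow> ('a \<Rightarrow> real) \<Rightarrow> ('a \<Rightarrow> real) \<Rightarrow> real \<Rightarrow> 'a list \<Rightarrow> 'a \<Rightarrow> real \<Rightarrow> 'a list \<Rightarrow> ('a \<times> real) set \<Rightarrow> bool"
  where
  "search_inv X f g m out L mu st H \<longleftrightarrow>
     (\<forall>x\<in>X. m \<le> g x) \<and> 0 \<le> mu \<and> wopt X f g mu L \<and> set out \<subseteq> X \<and> set st \<subseteq> X \<and>
     (\<forall>x\<in>set st. \<exists>a\<ge>0. \<forall>y\<in>X. a * f x + g x \<le> a * f y + g y) \<and>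
     sorted_wrt (stack_le f g m) (L # st) \<and> g (last (L # st)) = m \<and>
     (\<forall>l. 0 \<le> l \<and> l < mu \<longrightarrow> (\<exists>x\<in>set out. wopt X f g l x)) \<and>
     sorted_wrt (\<lambda>x y. g y < g x) (out @ [L]) \<and>
     (\<forall>x\<in>set out. pinned X f g x) \<and>
     finite H \<and>
     (\<forall>(p, l)\<in>H. 0 < l \<and> wopt X f g l p \<and> (g L \<le> g p \<or> p \<in> set st)) \<and>
     pairwise (\<lambda>(p, l) (q, k). \<not> (wopt X f g k p \<and> wopt X f g l q)) H"

text \<open>The right end \<open>b\<close> is supported by the second objective alone. This is why
  the weight of stack points is put on \<open>f\<close> in the invariant: \<open>b\<close> has
  weight 0. If \<open>a\<close> and \<open>b\<close> tie in \<open>g\<close>, optimality of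
  \<open>a\<close> for weight 0 orders them by \<open>f\<close>.\<close>

lemma search_inv_init:
  assumes "wopt X f g 0 a" "b \<in> X" "\<And>y. y \<in> X \<Longrightarrow> g b \<le> g y"
  shows "search_inv X f g (g b) [] a 0 [b] {}"
proof -
  have "stack_le f g (g b) a b"
    using woptD[OF assms(1,2)] assms(3)[OF wopt_in[OF assms(1)]]
    by (auto simp: stack_le_def)
  then show ?thesis
    using assms by (auto simp: search_inv_def intro: exI[of _ 0])
qed

text \<open>The last point has \<open>g\<close> equal to \<open>m\<close>, so \<open>L\<close> is
  not last, and its successor lies strictly to the right. Optimality of \<open>L\<close> for
  \<open>mu\<close> forces the weight at which both tie to be at least \<open>mu\<close>.\<close>

lemma search_inv_step:
  assumes inv: "search_inv X f g m out L mu st H" and m: "m < g L"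
  obtains R st' where "st = R # st'" "R \<in> X" "g R < g L" "mu \<le> (f R - f L) / (g L - g R)"
proof -
  have "st \<noteq> []" using inv m by (auto simp: search_inv_def)
  then obtain R st' where st: "st = R # st'" by (cases st) auto
  have R: "R \<in> X" "g R < g L"
    using inv m by (auto simp: search_inv_def st stack_le_def)
  have "wopt X f g mu L" using inv by (simp add: search_inv_def)
  from woptD[OF this R(1)] have "mu * (g L - g R) \<le> f R - f L"
    by (simp add: algebra_simps)
  then have "mu \<le> (f R - f L) / (g L - g R)"
    using R(2) by (simp add: pos_le_divide_eq)
  then show ?thesis using that st R by blast
qed

text \<open>At \<open>l\<close> the points \<open>L\<close> and \<open>R\<close> tie and
  \<open>p\<close> beats both. Everything optimal for \<open>l\<close> therefore lies between them,
  which keeps the stack sorted and shows that no earlier answer is optimal for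
  \<open>l\<close>.\<close>

lemma search_inv_push:
  assumes inv: "search_inv X f g m out L mu (R # st) H" and m: "m < g L"
    and l: "l = (f R - f L) / (g L - g R)"
    and p: "wopt X f g l p" "f p + l * g p < f L + l * g L"
  shows "search_inv X f g m out L mu (p # R # st) (insert (p, l) H)" and "(p, l) \<notin> H"
proof -
  have X: "R \<in> X" "p \<in> X" using inv p(1) by (auto simp: search_inv_def wopt_def)
  have RL: "g R < g L" and lmu: "mu \<le> l"
    using search_inv_step[OF inv m] l by auto
  have mu: "0 \<le> mu" "wopt X f g mu L" using inv by (simp_all add: search_inv_def)
  have mX: "\<And>x. x \<in> X \<Longrightarrow> m \<le> g x" using inv by (simp add: search_inv_def)
  have lR: "f L + l * g L = f R + l * g R"
  proof -
    have "l * (g L - g R) = f R - f L" using l RL by simp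
    then show ?thesis by (simp add: algebra_simps)
  qed
  \<comment> \<open>\<open>q\<close> beats \<open>L\<close> at \<open>l\<close> but not at the
    smaller weight \<open>mu\<close>, so \<open>q\<close> has the smaller \<open>g\<close>.\<close>
  have left: "g q < g L" and lmu': "mu < l"
    if q: "wopt X f g l q" for q
  proof -
    have "f q + l * g q < f L + l * g L"
      using woptD[OF q X(2)] p(2) by simp
    then have *: "(l - mu) * (g q - g L) < 0"
      using woptD[OF mu(2) wopt_in[OF q]] by (simp add: algebra_simps)
    then have "l \<noteq> mu" by auto
    then show "mu < l" using lmu by simp
    then show "g q < g L" using * by (simp add: mult_less_0_iff)
  qed
  have l0: "0 < l" using lmu'[OF p(1)] mu(1) by simp
  obtain a where a: "0 \<le> a" "\<And>y. y \<in> X \<Longrightarrow> a * f R + g R \<le> a * f y + g y"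
    using inv by (auto simp: search_inv_def)
  \<comment> \<open>The mirror image of \<open>left\<close>, with \<open>R\<close> supported by the
    weight \<open>a\<close> on \<open>f\<close>. Comparing \<open>R\<close> with \<open>L\<close>
    gives \<open>a * l\<close> at most 1, and equality would make \<open>R\<close> optimal for
    \<open>l\<close>.\<close>
  have right: "g R \<le> g q \<and> stack_le f g m q R" if q: "wopt X f g l q" for q
  proof -
    have q2: "f q + l * g q < f R + l * g R"
      using woptD[OF q X(2)] p(2) lR by simp
    have qX: "q \<in> X" using q by (rule wopt_in)
    have LX: "L \<in> X" using mu(2) by (rule wopt_in)
    have "a * (f R - f L) \<le> g L - g R" using a(2)[OF LX] by (simp add: algebra_simps)
    moreover have "f R - f L = l * (g L - g R)" using lR by (simp add: algebra_simps)
    ultimately have "(a * l) * (g L - g R) \<le> 1 * (g L - g R)" by simp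
    then have al: "a * l \<le> 1" using RL by (simp only: mult_le_cancel_right)
    have "a * l \<noteq> 1"
    proof
      assume al: "a * l = 1"
      have "l * (a * f R + g R) \<le> l * (a * f q + g q)"
        using a(2)[OF qX] l0 by simp
      then have "(a * l) * f R + l * g R \<le> (a * l) * f q + l * g q"
        by (simp add: algebra_simps)
      then show False using al q2 by simp
    qed
    then have al: "a * l < 1" using al by simp
    have "a * (f q - f R) \<le> a * (l * (g R - g q))"
      using q2 a(1) by (intro mult_left_mono) (simp_all add: algebra_simps)
    then have "(1 - a * l) * (g R - g q) \<le> 0"
      using a(2)[OF qX] by (simp add: algebra_simps)
    then have le: "g R \<le> g q" using al by (simp add: mult_le_0_iff)
    show ?thesis
    proof (cases "g R < g q")
      case True
      then show ?thesis by (simp add: stack_le_def)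
    next
      \<comment> \<open>In a tie, \<open>q\<close> is better in \<open>f\<close>, so the support of
        \<open>R\<close> can only be the second objective alone; then \<open>R\<close> attains the
        minimum \<open>m\<close>.\<close>
      case False
      then have eq: "g q = g R" using le by simp
      then have lt: "f q < f R" using q2 by simp
      have "a * (f R - f q) \<le> 0" using a(2)[OF qX] eq by (simp add: algebra_simps)
      then have "a = 0" using lt a(1) by (simp add: mult_le_0_iff)
      then have "g R \<le> g y" if "y \<in> X" for y using a(2)[OF that] by simp
      moreover have "g (last (R # st)) = m" "last (R # st) \<in> X"
        using inv by (auto simp: search_inv_def split: if_splits)
      ultimately have "g R \<le> m" by metis
      then have "g R = m" using mX[OF X(1)] by simp
      then show ?thesis using eq lt by (simp add: stack_le_def)
    qed
  qed
  have srt: "sorted_wrt (stack_le f g m) (L # R # st)" using inv by (simp add: search_inv_def)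
  have stX: "set st \<subseteq> X" using inv by (simp add: search_inv_def)
  \<comment> \<open>An earlier answer lies at or to the left of \<open>L\<close>, or on the stack.
    The first is excluded by \<open>left\<close>; \<open>R\<close> itself is beaten by
    \<open>p\<close>; and a point behind \<open>R\<close> can meet \<open>right\<close> only in a
    tie, where it is no better than \<open>R\<close>.\<close>
  have new: "\<not> wopt X f g l q" if qH: "(q, k) \<in> H" for q k
  proof
    assume q: "wopt X f g l q"
    have "g L \<le> g q \<or> q = R \<or> q \<in> set st" using inv qH by (auto simp: search_inv_def)
    moreover have "\<not> g L \<le> g q" using left[OF q] by simp
    moreover have q2: "f q + l * g q < f R + l * g R"
      using woptD[OF q X(2)] p(2) lR by simp
    ultimately have "q \<in> set st" by auto
    then have Rq: "stack_le f g m R q" using srt by simp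
    then have "g R \<le> g q" "f R \<le> f q" using right[OF q] by (auto simp: stack_le_def)
    then have "f R + l * g R \<le> f q + l * g q"
      using l0 by (intro add_mono mult_left_mono) auto
    then show False using q2 by simp
  qed
  then show "(p, l) \<notin> H" using p(1) by blast
  have "stack_le f g m p y" if y: "y \<in> set st" for y
  proof -
    have "stack_le f g m R y" "m \<le> g y" using srt y mX[of y] stX by auto
    then show ?thesis using right[OF p(1)] by (auto simp: stack_le_def)
  qed
  then have "sorted_wrt (stack_le f g m) (L # p # R # st)"
    using srt left[OF p(1)] right[OF p(1)] by (auto simp: stack_le_def)
  moreover have "\<forall>(q, k)\<in>insert (p, l) H. 0 < k \<and> wopt X f g k q \<and> (g L \<le> g q \<or> q \<in> set (p # R # st))"
    using inv p(1) l0 by (auto simp: search_inv_def)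
  moreover have "\<exists>a\<ge>0. \<forall>y\<in>X. a * f p + g p \<le> a * f y + g y"
  proof (intro exI conjI ballI)
    \<comment> \<open>Dividing the weighted sum by \<open>l\<close> turns the weight on
      \<open>g\<close> into the weight on \<open>f\<close> required of stack points.\<close>
    show "0 \<le> 1 / l" using l0 by simp
    fix y assume "y \<in> X"
    from woptD[OF p(1) this] have "1 / l * (f p + l * g p) \<le> 1 / l * (f y + l * g y)"
      using l0 by (intro mult_left_mono) auto
    then show "1 / l * f p + g p \<le> 1 / l * f y + g y"
      using l0 by (simp add: distrib_left)
  qed
  moreover have "pairwise (\<lambda>(p, l) (q, k). \<not> (wopt X f g k p \<and> wopt X f g l q)) (insert (p, l) H)"
    using inv new by (auto simp: search_inv_def pairwise_insert)
  ultimately show "search_inv X f g m out L mu (p # R # st) (insert (p, l) H)"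
    using inv X(2) unfolding search_inv_def by simp
qed

text \<open>As the optimal \<open>p\<close> does not beat \<open>L\<close>, both \<open>L\<close>
  and \<open>R\<close> are optimal for \<open>l\<close>. If \<open>mu < l\<close>, then
  \<open>L\<close> serves a whole interval of weights and is pinned; otherwise \<open>R\<close>
  replaces it at the same weight.\<close>

lemma search_inv_pop:
  assumes inv: "search_inv X f g m out L mu (R # st) H" and m: "m < g L"
    and l: "l = (f R - f L) / (g L - g R)"
    and p: "wopt X f g l p" "f L + l * g L \<le> f p + l * g p"
  shows "search_inv X f g m (if mu < l then out @ [L] else out) R l st H"
proof -
  have RL: "g R < g L" and lmu: "mu \<le> l" and RX: "R \<in> X"
    using search_inv_step[OF inv m] l by auto
  have mu: "0 \<le> mu" "wopt X f g mu L" using inv by (simp_all add: search_inv_def)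
  have lR: "f L + l * g L = f R + l * g R"
  proof -
    have "l * (g L - g R) = f R - f L" using l RL by simp
    then show ?thesis by (simp add: algebra_simps)
  qed
  have Ll: "wopt X f g l L"
    unfolding wopt_def using wopt_in[OF mu(2)] woptD[OF p(1)] p(2) by force
  then have Rl: "wopt X f g l R" using RX lR by (simp add: wopt_def)
  have srt: "sorted_wrt (stack_le f g m) (L # R # st)" using inv by (simp add: search_inv_def)
  have H: "\<forall>(p, l)\<in>H. 0 < l \<and> wopt X f g l p \<and> (g R \<le> g p \<or> p \<in> set st)"
    using inv RL by (fastforce simp: search_inv_def)
  have outs: "sorted_wrt (\<lambda>x y. g y < g x) (out @ [L])" using inv by (simp add: search_inv_def)
  show ?thesis
  proof (cases "mu < l")
    case True
    have "pinned X f g L" using pinned_between[OF mu(2) Ll mu(1) True] .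
    moreover have "\<exists>x\<in>set (out @ [L]). wopt X f g k x" if k: "0 \<le> k" "k < l" for k
    proof (cases "k < mu")
      case True
      then show ?thesis using inv k by (auto simp: search_inv_def)
    next
      case False
      then show ?thesis using wopt_between[OF mu(2) Ll, of k] k by auto
    qed
    moreover have "sorted_wrt (\<lambda>x y. g y < g x) ((out @ [L]) @ [R])"
      using outs RL by (fastforce simp: sorted_wrt_append)
    ultimately show ?thesis
      using inv True Rl H srt mu wopt_in[OF mu(2)] unfolding search_inv_def by auto
  next
    case False
    then have "l = mu" using lmu by simp
    moreover have "sorted_wrt (\<lambda>x y. g y < g x) (out @ [R])"
      using outs RL by (fastforce simp: sorted_wrt_append)
    ultimately show ?thesis
      using inv Rl H srt mu unfolding search_inv_def by auto
  qed
qed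

text \<open>Having the least \<open>g\<close>, the point \<open>L\<close> stays optimal for all
  weights from \<open>mu\<close> on, so it is pinned as well. Strict decrease of \<open>g\<close>
  along the list yields injectivity and distinctness.\<close>

lemma search_inv_final:
  assumes inv: "search_inv X f g m out L mu st H" and m: "\<not> m < g L"
  shows "\<And>l. 0 \<le> l \<Longrightarrow> \<exists>x\<in>set (out @ [L]). wopt X f g l x"
    and "\<And>x. x \<in> set (out @ [L]) \<Longrightarrow> pinned X f g x"
    and "inj_on g (set (out @ [L]))" and "distinct (out @ [L])" and "set (out @ [L]) \<subseteq> X"
proof -
  have mu: "0 \<le> mu" "wopt X f g mu L" using inv by (simp_all add: search_inv_def)
  have gL: "g L \<le> g y" if "y \<in> X" for y using inv m that by (force simp: search_inv_def)
  have ab: "wopt X f g l L" if "mu \<le> l" for l using wopt_above[OF mu(2) gL that] .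
  show "\<exists>x\<in>set (out @ [L]). wopt X f g l x" if l: "0 \<le> l" for l
  proof (cases "l < mu")
    case True
    then show ?thesis using inv l by (auto simp: search_inv_def)
  next
    case False
    then show ?thesis using ab[of l] by auto
  qed
  have "pinned X f g L" using pinned_between[OF mu(2) ab[of "mu + 1"]] mu(1) by simp
  then show "pinned X f g x" if "x \<in> set (out @ [L])" for x
    using inv that by (auto simp: search_inv_def)
  have "sorted_wrt (>) (map g (out @ [L]))"
    using inv unfolding search_inv_def sorted_wrt_map by blast
  then have "distinct (map g (out @ [L]))"
    using strict_sorted_iff[of "rev (map g (out @ [L]))"] 
    by (simp add: sorted_wrt_rev del: map_append)
  then show "inj_on g (set (out @ [L]))" "distinct (out @ [L])"
    unfolding distinct_map by blast+
  show "set (out @ [L]) \<subseteq> X"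
    using inv wopt_in[OF mu(2)] by (auto simp: search_inv_def)
qed

section \<open>The robust and the bicriteria problem\<close>

text \<open>Over the upper image, the image of \<open>x\<close> minimises the weighted sum and,
  among ties, has the largest second coordinate. Such a lexicographic optimum is never interior to a
  segment.\<close>

lemma wopt_max_efficient_extreme:
  assumes l: "0 < l" and x: "wopt_max X (dotp n chat) (dotp n d) l x"
  shows "x \<in> efficient_extreme n X chat d"
proof -
  let ?f = "dotp n chat" and ?g = "dotp n d"
  define h where "h u = fst u + l * snd u" for u :: "real \<times> real"
  define v where "v = biobj n chat d x"
  have o: "wopt X ?f ?g l x" and mx: "\<And>y. wopt X ?f ?g l y \<Longrightarrow> ?g y \<le> ?g x"
    using x by (auto simp: wopt_max_def)
  \<comment> \<open>The lexicographic half plane of all points that do not precede \<open>v\<close>;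
    being convex, it contains the hull once it contains the images.\<close>
  define W where "W = {u. h v < h u \<or> (h u = h v \<and> snd u \<le> snd v)}"
  have hlin: "h (a *\<^sub>R p + b *\<^sub>R q) = a * h p + b * h q" for a b p q
    by (simp add: h_def algebra_simps)
  have "convex W"
  proof (rule convexI)
    fix p q and a b :: real
    assume pq: "p \<in> W" "q \<in> W" and ab: "0 \<le> a" "0 \<le> b" "a + b = 1"
    have hv: "h v = a * h v + b * h v" and sv: "snd v = a * snd v + b * snd v"
      using ab(3) by (simp_all flip: distrib_right)
    have le: "a * h v \<le> a * h p" "b * h v \<le> b * h q"
      using pq ab by (auto simp: W_def intro!: mult_left_mono)
    show "a *\<^sub>R p + b *\<^sub>R q \<in> W"
    proof (cases "a * h p + b * h q = h v")
      case True
      then have eq: "a * h p = a * h v" "b * h q = b * h v" using le hv by linarith+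
      \<comment> \<open>If a coefficient vanishes, its equation says nothing about the point, but
        then both sides are 0.\<close>
      have "a * snd p \<le> a * snd v" "b * snd q \<le> b * snd v"
        using eq pq ab by (cases "a = 0"; cases "b = 0"; auto simp: W_def intro!: mult_left_mono)+
      then show ?thesis using True sv by (simp add: W_def hlin)
    next
      case False
      then have "h v < a * h p + b * h q" using le hv by linarith
      then show ?thesis by (simp add: W_def hlin)
    qed
  qed
  moreover have "biobj n chat d ` X \<subseteq> W"
  proof
    fix u assume "u \<in> biobj n chat d ` X"
    then obtain y where y: "y \<in> X" and u: "u = biobj n chat d y" by blast
    have le: "?f x + l * ?g x \<le> ?f y + l * ?g y" using woptD[OF o y] .
    show "u \<in> W"
    proof (cases "?f x + l * ?g x = ?f y + l * ?g y")
      case True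
      then have "wopt X ?f ?g l y" using o y by (simp add: wopt_def)
      from mx[OF this] True show ?thesis by (simp add: W_def u v_def h_def biobj_def)
    next
      case False
      then show ?thesis using le by (simp add: W_def u v_def h_def biobj_def)
    qed
  qed
  ultimately have hull: "convex hull (biobj n chat d ` X) \<subseteq> W" by (simp add: hull_minimal)
  have VW: "upper_image n X chat d \<subseteq> W"
  proof
    fix u assume "u \<in> upper_image n X chat d"
    then obtain p r where p: "p \<in> convex hull (biobj n chat d ` X)" and r: "0 \<le> fst r" "0 \<le> snd r"
      and u: "u = p + r"
      by (auto simp: upper_image_def)
    have pW: "p \<in> W" using p hull by blast
    have hu: "h u = h p + h r" by (simp add: u h_def algebra_simps)
    show "u \<in> W"
    proof (cases "r = 0")
      case True
      then show ?thesis using pW u by simp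
    next
      case False
      then have "0 < fst r \<or> 0 < snd r" using r by (auto simp: prod_eq_iff)
      \<comment> \<open>Positivity of \<open>l\<close> matters here: moving up along the second axis
        must strictly increase the weighted sum.\<close>
      then have "0 < h r" using r l by (auto simp: h_def add_pos_nonneg add_nonneg_pos)
      then show ?thesis using pW hu by (auto simp: W_def)
    qed
  qed
  have xX: "x \<in> X" using o by (rule wopt_in)
  have "v \<in> convex hull (biobj n chat d ` X)" unfolding v_def using xX by (simp add: hull_inc)
  then have "v + 0 \<in> upper_image n X chat d"
    unfolding upper_image_def by (intro CollectI exI conjI) (auto simp: zero_prod_def)
  then have vV: "v \<in> upper_image n X chat d" by simp
  have "v \<notin> open_segment p q"
    if "p \<in> upper_image n X chat d" "q \<in> upper_image n X chat d" for p q
  proof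
    assume "v \<in> open_segment p q"
    then obtain t where ne: "p \<noteq> q" and t: "0 < t" "t < 1" and v: "v = (1 - t) *\<^sub>R p + t *\<^sub>R q"
      by (auto simp: in_segment)
    have pq: "p \<in> W" "q \<in> W" using that VW by blast+
    have hv: "h v = (1 - t) * h p + t * h q" by (simp add: v hlin)
    have le: "(1 - t) * h v \<le> (1 - t) * h p" "t * h v \<le> t * h q"
      using pq t by (auto simp: W_def intro!: mult_left_mono)
    have "h v = (1 - t) * h v + t * h v" by (simp add: algebra_simps)
    then have "(1 - t) * h v = (1 - t) * h p" "t * h v = t * h q" using le hv by linarith+
    then have eq: "h p = h v" "h q = h v" using t by auto
    then have s: "snd p \<le> snd v" "snd q \<le> snd v" using pq by (auto simp: W_def)
    then have le: "(1 - t) * snd p \<le> (1 - t) * snd v" "t * snd q \<le> t * snd v"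
      using t by (auto intro!: mult_left_mono)
    have "snd v = (1 - t) * snd p + t * snd q" by (simp add: v)
    moreover have "snd v = (1 - t) * snd v + t * snd v" by (simp add: algebra_simps)
    ultimately have "(1 - t) * snd p = (1 - t) * snd v" "t * snd q = t * snd v" using le by linarith+
    then have "snd p = snd q" using t by auto
    moreover from this have "fst p = fst q" using eq by (simp add: h_def)
    ultimately show False using ne by (simp add: prod_eq_iff)
  qed
  then have "v extreme_point_of upper_image n X chat d"
    using vV by (auto simp: extreme_point_of_def)
  then show ?thesis using xX by (simp add: efficient_extreme_def v_def)
qed

text \<open>Without an equivalent member, \<open>x\<close> could be added to \<open>E\<close>,
  against maximality; and being an upper left end depends only on the image.\<close>

lemma E_min_wopt_max:
  assumes E: "is_E_min n X chat d E" and X: "finite X" "X \<noteq> {}" and l: "0 < l"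
  shows "\<exists>e\<in>E. wopt_max X (dotp n chat) (dotp n d) l e"
proof -
  obtain x where x: "wopt_max X (dotp n chat) (dotp n d) l x"
    using ex_wopt_max[OF X] by blast
  then have ex: "x \<in> efficient_extreme n X chat d" by (rule wopt_max_efficient_extreme[OF l])
  have "\<exists>e\<in>E. biobj n chat d e = biobj n chat d x"
  proof (rule ccontr)
    assume no: "\<not> ?thesis"
    then have "no_equivalent_pair n chat d (insert x E)"
      using E by (auto simp: is_E_min_def no_equivalent_pair_def)
    then have "insert x E = E"
      using E ex by (auto simp: is_E_min_def)
    then show False using no by blast
  qed
  then obtain e where e: "e \<in> E" "biobj n chat d e = biobj n chat d x" by blast
  then have "e \<in> X" using E by (auto simp: is_E_min_def efficient_extreme_def)
  then have "wopt_max X (dotp n chat) (dotp n d) l e"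
    using x e(2) by (simp add: wopt_max_def wopt_def biobj_def)
  then show ?thesis using e(1) by blast
qed

text \<open>For nonnegative \<open>x\<close> each coordinate is worst at the upper end of its
  interval, so the maximum is attained at the corner \<open>d\<close> of the box.\<close>

lemma worst_case_box:
  assumes x: "\<And>i. i < n \<Longrightarrow> 0 \<le> x i" and d: "\<And>i. i < n \<Longrightarrow> 0 \<le> d i" and lam: "0 \<le> lam"
  shows "worst_case n (uncertainty_set n chat (box_set n d) lam) x
    = dotp n chat x + lam * dotp n d x"
  unfolding worst_case_def
proof (rule cSup_eq_maximum)
  \<comment> \<open>The restriction is there because members of the box are extensional, whereas
    \<open>d\<close> is arbitrary beyond \<open>n\<close> here.\<close>
  have "(\<lambda>i\<in>{..<n}. d i) \<in> box_set n d"
    using d by (auto simp: box_set_def intro: order_trans[of _ 0])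
  moreover have "dotp n (\<lambda>i\<in>{..<n}. chat i + lam * (\<lambda>i\<in>{..<n}. d i) i) x
      = dotp n chat x + lam * dotp n d x"
    by (simp add: dotp_def algebra_simps sum.distrib sum_distrib_left)
  ultimately show "dotp n chat x + lam * dotp n d x
      \<in> (\<lambda>c. dotp n c x) ` uncertainty_set n chat (box_set n d) lam"
    unfolding uncertainty_set_def
    by (intro image_eqI[where x = "\<lambda>i\<in>{..<n}. chat i + lam * (\<lambda>i\<in>{..<n}. d i) i"]
        CollectI exI[of _ "\<lambda>i\<in>{..<n}. d i"] conjI) (simp_all only:)
next
  fix r assume "r \<in> (\<lambda>c. dotp n c x) ` uncertainty_set n chat (box_set n d) lam"
  then obtain b where b: "b \<in> box_set n d"
    and r: "r = dotp n (\<lambda>i\<in>{..<n}. chat i + lam * b i) x"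
    by (auto simp: uncertainty_set_def)
  have "r = (\<Sum>i<n. (chat i + lam * b i) * x i)" by (simp add: r dotp_def)
  also have "\<dots> \<le> (\<Sum>i<n. (chat i + lam * d i) * x i)"
  proof (rule sum_mono)
    fix i assume i: "i \<in> {..<n}"
    then have "b i \<le> d i" using b by (auto simp: box_set_def PiE_iff)
    then show "(chat i + lam * b i) * x i \<le> (chat i + lam * d i) * x i"
      using i x lam by (intro mult_right_mono add_left_mono mult_left_mono) auto
  qed
  also have "\<dots> = dotp n chat x + lam * dotp n d x"
    by (simp add: dotp_def algebra_simps sum.distrib sum_distrib_left)
  finally show "r \<le> dotp n chat x + lam * dotp n d x" .
qed

lemma robust_optimal_iff:
  assumes X: "X \<subseteq> {..<n} \<rightarrow>\<^sub>E {0, 1}" and d: "d \<in> {..<n} \<rightarrow>\<^sub>E {0..}" and lam: "0 \<le> lam"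
  shows "robust_optimal n X chat (box_set n d) lam x \<longleftrightarrow> wopt X (dotp n chat) (dotp n d) lam x"
proof -
  have "worst_case n (uncertainty_set n chat (box_set n d) lam) y
      = dotp n chat y + lam * dotp n d y" if "y \<in> X" for y
  proof (rule worst_case_box[OF _ _ lam])
    fix i assume i: "i < n"
    then have "y i \<in> {0, 1}" using X that by (auto simp: PiE_iff)
    then show "0 \<le> y i" by auto
    show "0 \<le> d i" using d i by (auto simp: PiE_iff)
  qed
  then show ?thesis
    by (auto simp: robust_optimal_def is_arg_min_linorder wopt_def)
qed

lemma variable_sized_solutionI:
  assumes X: "X \<subseteq> {..<n} \<rightarrow>\<^sub>E {0, 1}" and d: "d \<in> {..<n} \<rightarrow>\<^sub>E {0..}"
    and S: "S \<subseteq> X" "\<And>x. x \<in> S \<Longrightarrow> pinned X (dotp n chat) (dotp n d) x" "inj_on (dotp n d) S"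
    and cov: "\<And>l. 0 \<le> l \<Longrightarrow> \<exists>x\<in>S. wopt X (dotp n chat) (dotp n d) l x"
  shows "variable_sized_solution n X chat (box_set n d) S"
  unfolding variable_sized_solution_def covers_all_sizes_def
proof (intro conjI allI impI)
  show "\<exists>x\<in>S. robust_optimal n X chat (box_set n d) lam x" if "0 \<le> lam" for lam
    using cov[OF that] robust_optimal_iff[OF X d that] by auto
  fix S' assume S': "S' \<subseteq> X \<and> (\<forall>lam\<ge>0. \<exists>x\<in>S'. robust_optimal n X chat (box_set n d) lam x)"
  have "finite X" using X by (rule finite_subset) (simp add: finite_PiE)
  \<comment> \<open>An infinite set would have \<open>card\<close> 0, so the comparison relies on
    finiteness of \<open>S'\<close>.\<close>
  then have fin: "finite S'" using S' by (auto intro: finite_subset)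
  have opt: "\<exists>x\<in>S'. wopt X (dotp n chat) (dotp n d) l x" if "0 < l" for l
    using S' robust_optimal_iff[OF X d less_imp_le[OF that], of chat] less_imp_le[OF that] by blast
  show "card S \<le> card S'"
    using S(2) by (rule card_pinned_le[OF _ S(3) fin opt])
qed (use S(1) in blast)

section \<open>Reasoning about programs and their running time\<close>

text \<open>The argument \<open>t0\<close> is the time spent before; \<open>Q\<close> is told the total time.\<close>

definition wp :: "nat \<Rightarrow> (vect \<Rightarrow> vect) \<Rightarrow> nat \<Rightarrow> com \<Rightarrow> (state \<Rightarrow> nat \<Rightarrow> bool) \<Rightarrow> state \<Rightarrow> nat \<Rightarrow> bool" where
  "wp n orc T P Q s t0 \<longleftrightarrow> (\<exists>t s'. exec n orc T P s t s' \<and> Q s' (t0 + t))"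

lemma wp_Skip: "Q s (t0 + 1) \<Longrightarrow> wp n orc T Skip Q s t0"
  unfolding wp_def by (blast intro: exec.Skip)

lemma wp_ISet: "Q (set_reg v (ival s e) s) (t0 + (1 + icost e)) \<Longrightarrow> wp n orc T (ISet v e) Q s t0"
  unfolding wp_def by (blast intro: exec.ISet)

lemma wp_RSet:
  "Q (set_cell a (ival s e) (rval s p) s) (t0 + (1 + icost e + rcost p)) \<Longrightarrow>
    wp n orc T (RSet a e p) Q s t0"
  unfolding wp_def by (blast intro: exec.RSet)

lemma wp_Query:
  "Q (write_block n b (ival s f) (orc (read_block n a (ival s e) s)) s) (t0 + (T + icost e + icost f)) \<Longrightarrow>
    wp n orc T (Query a e b f) Q s t0"
  unfolding wp_def by (blast intro: exec.Query)

lemma wp_Seq: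
  assumes "wp n orc T P (wp n orc T P' Q) s t0"
  shows "wp n orc T (Seq P P') Q s t0"
proof -
  obtain t s' t' s'' where "exec n orc T P s t s'" "exec n orc T P' s' t' s''" "Q s'' (t0 + t + t')"
    using assms unfolding wp_def by blast
  then have "exec n orc T (Seq P P') s (t + t') s''" "Q s'' (t0 + (t + t'))"
    by (auto intro: exec.Seq simp: add.assoc)
  then show ?thesis unfolding wp_def by blast
qed

lemma wp_Cond:
  assumes "bval s b \<Longrightarrow> wp n orc T P Q s (t0 + (1 + bcost b))"
    and "\<not> bval s b \<Longrightarrow> wp n orc T P' Q s (t0 + (1 + bcost b))"
  shows "wp n orc T (Cond b P P') Q s t0"
proof (cases "bval s b")
  case True
  then obtain t s' where "exec n orc T P s t s'" "Q s' (t0 + (1 + bcost b) + t)"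
    using assms(1) unfolding wp_def by blast
  then show ?thesis using exec.CondTrue[OF True] unfolding wp_def by (metis add.assoc)
next
  case False
  then obtain t s' where "exec n orc T P' s t s'" "Q s' (t0 + (1 + bcost b) + t)"
    using assms(2) unfolding wp_def by blast
  then show ?thesis using exec.CondFalse[OF False] unfolding wp_def by (metis add.assoc)
qed

lemma wp_conseq:
  assumes "wp n orc T P R s t0" and "\<And>s' t. R s' t \<Longrightarrow> Q s' t"
  shows "wp n orc T P Q s t0"
  using assms unfolding wp_def by blast

text \<open>\<open>k\<close> bounds the rounds left and \<open>c\<close> the time of one round;
  \<open>k + 1\<close> pays for the final failing test.\<close>

lemma wp_While:
  assumes "I k s"
    and "\<And>k s t. I k s \<Longrightarrow> bval s b \<Longrightarrow>
      wp n orc T P (\<lambda>s' t'. t' \<le> t + c \<and> (\<exists>k'<k. I k' s')) s t"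
    and "\<And>k s t. I k s \<Longrightarrow> \<not> bval s b \<Longrightarrow> t \<le> tb \<Longrightarrow> Q s t"
    and "t0 + (k + 1) * (1 + bcost b + c) \<le> tb"
  shows "wp n orc T (While b P) Q s t0"
  using assms(1,4)
proof (induction k arbitrary: s t0 rule: less_induct)
  case (less k)
  show ?case
  proof (cases "bval s b")
    case True
    from assms(2)[OF less.prems(1) True, of "t0 + (1 + bcost b)"]
    obtain t s' k' where t: "exec n orc T P s t s'" "t0 + (1 + bcost b) + t \<le> t0 + (1 + bcost b) + c"
      and k': "k' < k" "I k' s'"
      unfolding wp_def by blast
    have "(k' + 1) * (1 + bcost b + c) \<le> k * (1 + bcost b + c)"
      using k'(1) by (intro mult_le_mono1) simp
    then have "t0 + (1 + bcost b + t) + (k' + 1) * (1 + bcost b + c) \<le> tb"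
      using t(2) less.prems(2) by (simp add: algebra_simps)
    from less.IH[OF k' this]
    obtain t' s'' where t': "exec n orc T (While b P) s' t' s''" "Q s'' (t0 + (1 + bcost b + t) + t')"
      unfolding wp_def by blast
    have "exec n orc T (While b P) s (1 + bcost b + t + t') s''"
      by (rule exec.WhileTrue[OF True t(1) t'(1)])
    moreover have "Q s'' (t0 + (1 + bcost b + t + t'))" using t'(2) by (simp add: add.assoc)
    ultimately show ?thesis unfolding wp_def by blast
  next
    case False
    have "t0 + (1 + bcost b) \<le> tb" using less.prems(2) by (simp add: algebra_simps)
    then have "Q s (t0 + (1 + bcost b))" using assms(3)[OF less.prems(1) False] by blast
    then show ?thesis using exec.WhileFalse[OF False] unfolding wp_def by blast
  qed
qed

section \<open>Loops over the coordinates\<close>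

definition for_prog :: "com \<Rightarrow> com" where
  "for_prog P = Seq (ISet 4 (INum 0))
     (While (ILess (IReg 4) (IReg 0)) (Seq P (ISet 4 (IAdd (IReg 4) (INum 1)))))"

lemma fst_set_reg [simp]: "fst (set_reg v k s) = (fst s)(v := k)"
  by (simp add: set_reg_def)

lemma snd_set_reg [simp]: "snd (set_reg v k s) = snd s"
  by (simp add: set_reg_def)

lemma fst_set_cell [simp]: "fst (set_cell a i r s) = fst s"
  by (simp add: set_cell_def)

lemma snd_set_cell [simp]: "snd (set_cell a i r s) = (snd s)(a := (snd s a)(i := r))"
  by (simp add: set_cell_def)

lemma fst_write_block [simp]: "fst (write_block n a i x s) = fst s"
  by (simp add: write_block_def)

lemma snd_write_block [simp]:
  "snd (write_block n a i x s) =
    (snd s)(a := (\<lambda>k. if i \<le> k \<and> k < i + n then x (k - i) else snd s a k))"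
  by (simp add: write_block_def)

lemma set_reg_set_reg [simp]: "set_reg v k (set_reg v l s) = set_reg v k s"
  by (simp add: set_reg_def)

lemma write_block_0 [simp]: "write_block 0 a i x s = s"
  by (cases s) (auto simp: write_block_def fun_eq_iff)

lemma write_block_Suc: "write_block (Suc m) a i x s = set_cell a (i + m) (x m) (write_block m a i x s)"
  by (auto simp: write_block_def set_cell_def fun_eq_iff)

lemma set_cell_set_reg: "set_cell a i r (set_reg v k s) = set_reg v k (set_cell a i r s)"
  by (simp add: set_reg_def set_cell_def)

text \<open>\<open>g i\<close> is the state after \<open>i\<close> rounds, up to the counter in
  register 4. An explicit state takes the place of an invariant.\<close>

lemma wp_for_prog:
  assumes n: "fst s 0 = n"
    and g: "g 0 = s" "\<And>i. fst (g i) 0 = n"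
    and body: "\<And>i t. i < n \<Longrightarrow>
      wp n orc T P (\<lambda>s' t'. t' \<le> t + c \<and> s' = set_reg 4 i (g (Suc i))) (set_reg 4 i (g i)) t"
    and Q: "\<And>t. t \<le> t0 + (2 + (n + 1) * (c + 8)) \<Longrightarrow> Q (set_reg 4 n (g n)) t"
  shows "wp n orc T (for_prog P) Q s t0"
  unfolding for_prog_def
\<comment> \<open>\<open>k\<close> counts the rounds left, so the counter is \<open>n - k\<close>.
  The increment and the test cost 4 each.\<close>
proof (rule wp_Seq, rule wp_ISet, rule wp_While[where k = n and c = "c + 4" and
      I = "\<lambda>k s'. k \<le> n \<and> s' = set_reg 4 (n - k) (g (n - k))" and tb = "t0 + (2 + (n + 1) * (c + 8))"])
  show "n \<le> n \<and> set_reg 4 (ival s (INum 0)) s = set_reg 4 (n - n) (g (n - n))"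
    using g(1) by simp
next
  fix k s' t
  assume I: "k \<le> n \<and> s' = set_reg 4 (n - k) (g (n - k))" and "bval s' (ILess (IReg 4) (IReg 0))"
  then have k: "0 < k" by (cases k) (auto simp: g(2))
  define i where "i = n - k"
  have i: "i < n" "k = n - i" "s' = set_reg 4 i (g i)" using I k by (auto simp: i_def)
  show "wp n orc T (Seq P (ISet 4 (IAdd (IReg 4) (INum 1))))
      (\<lambda>s' t'. t' \<le> t + (c + 4) \<and> (\<exists>k'<k. k' \<le> n \<and> s' = set_reg 4 (n - k') (g (n - k')))) s' t"
    unfolding i(3)
  proof (rule wp_Seq, rule wp_conseq[OF body[OF i(1)]], rule wp_ISet)
    fix s'' t'
    assume "t' \<le> t + c \<and> s'' = set_reg 4 i (g (Suc i))"
    then show "t' + (1 + icost (IAdd (IReg 4) (INum 1))) \<le> t + (c + 4) \<and>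
        (\<exists>k'<k. k' \<le> n \<and>
          set_reg 4 (ival s'' (IAdd (IReg 4) (INum 1))) s'' = set_reg 4 (n - k') (g (n - k')))"
      using i(1,2) by (auto intro!: exI[of _ "n - Suc i"])
  qed
next
  fix k s' t
  assume I: "k \<le> n \<and> s' = set_reg 4 (n - k) (g (n - k))" and "\<not> bval s' (ILess (IReg 4) (IReg 0))"
    and t: "t \<le> t0 + (2 + (n + 1) * (c + 8))"
  then have "k = 0" by (auto simp: g(2))
  then show "Q s' t" using I Q[OF t] by simp
next
  show "t0 + (1 + icost (INum 0)) + (n + 1) * (1 + bcost (ILess (IReg 4) (IReg 0)) + (c + 4))
      \<le> t0 + (2 + (n + 1) * (c + 8))"
    by (simp add: algebra_simps)
qed

definition fill_prog :: "nat \<Rightarrow> iexp \<Rightarrow> rexp \<Rightarrow> com" where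
  "fill_prog b e p = for_prog (RSet b (IAdd e (IReg 4)) p)"

text \<open>\<open>e\<close> and \<open>p\<close> are evaluated anew in each round; hence the
  hypotheses about partially written blocks.\<close>

lemma wp_fill_prog:
  assumes n: "fst s 0 = n"
    and e: "\<And>i m. ival (set_reg 4 i (write_block m b j x s)) e = j"
    and p: "\<And>i. i < n \<Longrightarrow> rval (set_reg 4 i (write_block i b j x s)) p = x i"
    and Q: "\<And>t. t \<le> t0 + (2 + (n + 1) * (icost e + rcost p + 11)) \<Longrightarrow>
      Q (set_reg 4 n (write_block n b j x s)) t"
  shows "wp n orc T (fill_prog b e p) Q s t0"
  unfolding fill_prog_def
proof (rule wp_for_prog[where g = "\<lambda>i. write_block i b j x s" and c = "3 + icost e + rcost p", OF n])
  fix i t assume i: "i < n"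
  show "wp n orc T (RSet b (IAdd e (IReg 4)) p)
      (\<lambda>s' t'. t' \<le> t + (3 + icost e + rcost p) \<and> s' = set_reg 4 i (write_block (Suc i) b j x s))
      (set_reg 4 i (write_block i b j x s)) t"
    by (rule wp_RSet) (simp add: e p[OF i] write_block_Suc set_cell_set_reg)
next
  fix t assume "t \<le> t0 + (2 + (n + 1) * (3 + icost e + rcost p + 8))"
  then show "Q (set_reg 4 n (write_block n b j x s)) t"
    by (intro Q) (simp add: algebra_simps)
qed (simp_all add: n)

text \<open>The vector to be evaluated starts in array \<open>a\<close> at the index held by register 5.\<close>

definition dot_prog :: "nat \<Rightarrow> nat \<Rightarrow> nat \<Rightarrow> com" where
  "dot_prog a c1 c2 =
     Seq (RSet 5 (INum c1) (RNum 0)) (Seq (RSet 5 (INum c2) (RNum 0))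
       (for_prog
         (Seq (RSet 5 (INum c1) (RAdd (RCell 5 (INum c1))
                (RMul (RCell 0 (IReg 4)) (RCell a (IAdd (IReg 5) (IReg 4))))))
              (RSet 5 (INum c2) (RAdd (RCell 5 (INum c2))
                (RMul (RCell 1 (IReg 4)) (RCell a (IAdd (IReg 5) (IReg 4)))))))))"

lemma wp_dot_prog:
  assumes n: "fst s 0 = n" and c: "c1 \<noteq> c2" and a: "a \<noteq> 5"
    and chat: "\<And>i. i < n \<Longrightarrow> snd s 0 i = chat i" and d: "\<And>i. i < n \<Longrightarrow> snd s 1 i = d i"
    and x: "read_block n a (fst s 5) s = x"
    and Q: "\<And>t. t \<le> t0 + 50 * (n + 1) \<Longrightarrow>
      Q (set_reg 4 n (set_cell 5 c2 (dotp n d x) (set_cell 5 c1 (dotp n chat x) s))) t"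
  shows "wp n orc T (dot_prog a c1 c2) Q s t0"
proof -
  \<comment> \<open>The two partial scalar products after \<open>i\<close> coordinates.\<close>
  define g where "g i = set_cell 5 c2 (\<Sum>j<i. d j * x j) (set_cell 5 c1 (\<Sum>j<i. chat j * x j) s)" for i
  have xi: "snd s a (fst s 5 + i) = x i" if "i < n" for i
    using x that by (auto simp: read_block_def)
  show ?thesis
    unfolding dot_prog_def
  proof (rule wp_Seq, rule wp_RSet, rule wp_Seq, rule wp_RSet, rule wp_for_prog[where g = g and c = 24])
    fix i t assume i: "i < n"
    show "wp n orc T
        (Seq (RSet 5 (INum c1) (RAdd (RCell 5 (INum c1))
                (RMul (RCell 0 (IReg 4)) (RCell a (IAdd (IReg 5) (IReg 4))))))
              (RSet 5 (INum c2) (RAdd (RCell 5 (INum c2))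
                (RMul (RCell 1 (IReg 4)) (RCell a (IAdd (IReg 5) (IReg 4)))))))
        (\<lambda>s' t'. t' \<le> t + 24 \<and> s' = set_reg 4 i (g (Suc i))) (set_reg 4 i (g i)) t"
      by (rule wp_Seq, rule wp_RSet, rule wp_RSet)
        (use c a i in \<open>simp add: g_def chat d[unfolded One_nat_def] xi set_cell_set_reg,
          simp add: set_reg_def set_cell_def fun_eq_iff\<close>)
  next
    fix t
    assume "t \<le> t0 + (1 + icost (INum c1) + rcost (RNum 0)) + (1 + icost (INum c2) + rcost (RNum 0)) +
        (2 + (n + 1) * (24 + 8))"
    then have "t \<le> t0 + 50 * (n + 1)" by simp
    from Q[OF this] show "Q (set_reg 4 n (g n)) t" by (simp add: g_def dotp_def)
  qed (simp_all add: n g_def)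
qed

section \<open>The program\<close>

definition blocks :: "nat \<Rightarrow> nat \<Rightarrow> vect list \<Rightarrow> state \<Rightarrow> bool" where
  "blocks n a xs s \<longleftrightarrow> (\<forall>k<length xs. read_block n a (k * n) s = xs ! k)"

lemma read_block_set_reg [simp]: "read_block n a i (set_reg v k s) = read_block n a i s"
  by (simp add: read_block_def)

lemma read_block_set_cell [simp]: "a \<noteq> b \<Longrightarrow> read_block n a i (set_cell b j r s) = read_block n a i s"
  by (simp add: read_block_def)

lemma read_block_write_block_other [simp]:
  "a \<noteq> b \<Longrightarrow> read_block n a i (write_block n b j x s) = read_block n a i s"
  by (simp add: read_block_def)

lemma read_block_write_block [simp]:
  "x \<in> extensional {..<n} \<Longrightarrow> read_block n a i (write_block n a i x s) = x"
  by (auto simp: read_block_def fun_eq_iff extensional_def)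

lemma read_block_write_block_above:
  "i + n \<le> j \<Longrightarrow> read_block n a i (write_block n a j x s) = read_block n a i s"
  by (auto simp: read_block_def fun_eq_iff)

lemma blocks_set_reg [simp]: "blocks n a xs (set_reg v k s) = blocks n a xs s"
  by (simp add: blocks_def)

lemma blocks_set_cell [simp]: "a \<noteq> b \<Longrightarrow> blocks n a xs (set_cell b j r s) = blocks n a xs s"
  by (simp add: blocks_def)

lemma blocks_write_block_other [simp]:
  "a \<noteq> b \<Longrightarrow> blocks n a xs (write_block n b j x s) = blocks n a xs s"
  by (simp add: blocks_def)

lemma blocks_append:
  "blocks n a (xs @ [x]) s \<longleftrightarrow> blocks n a xs s \<and> read_block n a (length xs * n) s = x"
  by (auto simp: blocks_def nth_append less_Suc_eq all_conj_distrib)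

lemma blocks_write_block_above:
  assumes "blocks n a xs s"
  shows "blocks n a xs (write_block n a (length xs * n) x s)"
  unfolding blocks_def
proof (intro allI impI)
  fix k assume k: "k < length xs"
  then have "Suc k * n \<le> length xs * n" by (intro mult_le_mono1) simp
  then have "k * n + n \<le> length xs * n" by simp
  then show "read_block n a (k * n) (write_block n a (length xs * n) x s) = xs ! k"
    using assms k by (simp add: read_block_write_block_above blocks_def)
qed

text \<open>
  Register 2 points to the current point in the output array 2, register 3 to the first free block
  of the stack in array 3. Array 5 holds scalars: the least value of the second objective, the last
  weight, and the objectives of the current point; cells from 4 on are scratch.
\<close>

definition rep ::
  "nat \<Rightarrow> vect \<Rightarrow> vect \<Rightarrow> real \<Rightarrow> vect list \<Rightarrow> vect \<Rightarrow> real \<Rightarrow> vect list \<Rightarrow> state \<Rightarrow> bool" where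
  "rep n chat d m out L mu st s \<longleftrightarrow>
     fst s 0 = n \<and> (\<forall>i<n. snd s 0 i = chat i) \<and> (\<forall>i<n. snd s 1 i = d i) \<and>
     fst s 1 = Suc (length out) \<and> fst s 2 = length out * n \<and> fst s 3 = length st * n \<and>
     blocks n 2 (out @ [L]) s \<and> blocks n 3 (rev st) s \<and>
     snd s 5 0 = m \<and> snd s 5 1 = mu \<and> snd s 5 2 = dotp n chat L \<and> snd s 5 3 = dotp n d L"

lemma rep_set_reg: "3 < v \<Longrightarrow> rep n chat d m out L mu st (set_reg v k s) = rep n chat d m out L mu st s"
  by (simp add: rep_def)

lemma rep_set_cell:
  "3 < c \<Longrightarrow> rep n chat d m out L mu st (set_cell 5 c r s) = rep n chat d m out L mu st s"
  by (simp add: rep_def)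

lemma rep_write_block_4:
  "rep n chat d m out L mu st (write_block n 4 j x s) = rep n chat d m out L mu st s"
  by (simp add: rep_def)

text \<open>An answer is written just above the stack and joins it only when register 3 advances, so
  an unsuccessful query leaves nothing to undo.\<close>

lemma rep_write_block_3:
  "rep n chat d m out L mu st s \<Longrightarrow> rep n chat d m out L mu st (write_block n 3 (length st * n) x s)"
  using blocks_write_block_above[of n 3 "rev st" s x] by (simp add: rep_def)

text \<open>Scratch cells of array 5: 4 and 5 hold the objectives of the stack top \<open>R\<close>,
  8 the weight at which \<open>L\<close> and \<open>R\<close> tie, 6 and 7 the objectives of the
  answer. Array 4 takes the cost vector.\<close>

definition query_prog :: com where
  "query_prog =
     Seq (ISet 5 (ISub (IReg 3) (IReg 0)))
    (Seq (dot_prog 3 4 5)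
    (Seq (RSet 5 (INum 8) (RDiv (RSub (RCell 5 (INum 4)) (RCell 5 (INum 2)))
                                (RSub (RCell 5 (INum 3)) (RCell 5 (INum 5)))))
    (Seq (fill_prog 4 (INum 0)
           (RAdd (RCell 0 (IReg 4)) (RMul (RCell 5 (INum 8)) (RCell 1 (IReg 4)))))
    (Seq (Query 4 (INum 0) 3 (IReg 3))
    (Seq (ISet 5 (IReg 3))
         (dot_prog 3 6 7))))))"

lemma wp_query_prog:
  assumes rep: "rep n chat d m out L mu (R # st) s"
    and l: "l = (dotp n chat R - dotp n chat L) / (dotp n d L - dotp n d R)"
    and p: "p = orc (\<lambda>i\<in>{..<n}. chat i + l * d i)" "p \<in> extensional {..<n}"
    and Q: "\<And>s' t. t \<le> t0 + (T + 200 * (n + 1)) \<Longrightarrow> rep n chat d m out L mu (R # st) s' \<Longrightarrow>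
      read_block n 3 (length (R # st) * n) s' = p \<Longrightarrow>
      snd s' 5 4 = dotp n chat R \<Longrightarrow> snd s' 5 5 = dotp n d R \<Longrightarrow>
      snd s' 5 6 = dotp n chat p \<Longrightarrow> snd s' 5 7 = dotp n d p \<Longrightarrow> snd s' 5 8 = l \<Longrightarrow> Q s' t"
  shows "wp n orc T query_prog Q s t0"
proof -
  have R: "read_block n 3 (length st * n) s = R"
    using rep by (simp add: rep_def blocks_append)
  have n: "fst s 0 = n" and sp: "fst s 3 = length (R # st) * n"
    and chat: "\<And>i. i < n \<Longrightarrow> snd s 0 i = chat i" and d: "\<And>i. i < n \<Longrightarrow> snd s 1 i = d i"
    and L: "snd s 5 2 = dotp n chat L" "snd s 5 3 = dotp n d L"
    using rep by (simp_all add: rep_def)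
  define s1 where "s1 = set_reg 5 (length st * n) s"
  define s2 where "s2 = set_reg 4 n (set_cell 5 5 (dotp n d R) (set_cell 5 4 (dotp n chat R) s1))"
  define s3 where "s3 = set_cell 5 8 l s2"
  define c where "c = (\<lambda>i\<in>{..<n}. chat i + l * d i)"
  define s4 where "s4 = set_reg 4 n (write_block n 4 0 c s3)"
  define s5 where "s5 = write_block n 3 (length (R # st) * n) p s4"
  define s6 where "s6 = set_reg 5 (length (R # st) * n) s5"
  define s7 where "s7 = set_reg 4 n (set_cell 5 7 (dotp n d p) (set_cell 5 6 (dotp n chat p) s6))"
  note defs = s1_def s2_def s3_def s4_def s5_def s6_def s7_def
  have rep4: "rep n chat d m out L mu (R # st) s4"
    using rep by (simp add: defs rep_set_reg rep_set_cell rep_write_block_4)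
  then have rep5: "rep n chat d m out L mu (R # st) s5"
    unfolding s5_def by (rule rep_write_block_3)
  then have rep7: "rep n chat d m out L mu (R # st) s7"
    by (simp add: s7_def s6_def rep_set_reg rep_set_cell)
  have ext: "c \<in> extensional {..<n}" by (simp add: c_def)
  show ?thesis
    unfolding query_prog_def
  proof (rule wp_Seq, rule wp_ISet, rule wp_Seq, rule wp_dot_prog[where chat = chat and d = d and x = R])
    fix t1 assume t1: "t1 \<le> t0 + (1 + icost (ISub (IReg 3) (IReg 0))) + 50 * (n + 1)"
    have eq1: "set_reg 5 (ival s (ISub (IReg 3) (IReg 0))) s = s1" by (simp add: s1_def n sp)
    show "wp n orc T (Seq (RSet 5 (INum 8) (RDiv (RSub (RCell 5 (INum 4)) (RCell 5 (INum 2)))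
                                (RSub (RCell 5 (INum 3)) (RCell 5 (INum 5)))))
      (Seq (fill_prog 4 (INum 0)
           (RAdd (RCell 0 (IReg 4)) (RMul (RCell 5 (INum 8)) (RCell 1 (IReg 4)))))
      (Seq (Query 4 (INum 0) 3 (IReg 3))
      (Seq (ISet 5 (IReg 3))
         (dot_prog 3 6 7))))) Q
      (set_reg 4 n (set_cell 5 5 (dotp n d R) (set_cell 5 4 (dotp n chat R)
        (set_reg 5 (ival s (ISub (IReg 3) (IReg 0))) s)))) t1"
      unfolding eq1 s2_def[symmetric]
    proof (rule wp_Seq, rule wp_RSet)
      let ?D = "RDiv (RSub (RCell 5 (INum 4)) (RCell 5 (INum 2)))
                                (RSub (RCell 5 (INum 3)) (RCell 5 (INum 5)))"
      have eq3: "set_cell 5 (ival s2 (INum 8)) (rval s2 ?D) s2 = s3"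
        by (simp add: s3_def s2_def s1_def L l)
      show "wp n orc T (Seq (fill_prog 4 (INum 0)
           (RAdd (RCell 0 (IReg 4)) (RMul (RCell 5 (INum 8)) (RCell 1 (IReg 4)))))
          (Seq (Query 4 (INum 0) 3 (IReg 3)) (Seq (ISet 5 (IReg 3)) (dot_prog 3 6 7)))) Q
        (set_cell 5 (ival s2 (INum 8)) (rval s2 ?D) s2) (t1 + (1 + icost (INum 8) + rcost ?D))"
        unfolding eq3
      proof (rule wp_Seq, rule wp_fill_prog[where x = c and j = 0])
        let ?e = "RAdd (RCell 0 (IReg 4)) (RMul (RCell 5 (INum 8)) (RCell 1 (IReg 4)))"
        fix t2 assume t2: "t2 \<le> t1 + (1 + icost (INum 8) + rcost ?D) +
            (2 + (n + 1) * (icost (INum 0) + rcost ?e + 11))"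
        have eq5: "write_block n 3 (ival s4 (IReg 3)) (orc (read_block n 4 (ival s4 (INum 0)) s4)) s4 = s5"
          using p(1) ext by (simp add: s5_def s4_def s3_def s2_def s1_def sp flip: c_def)
        have eq6: "set_reg 5 (ival s5 (IReg 3)) s5 = s6"
          by (simp add: s6_def s5_def s4_def s3_def s2_def s1_def sp)
        show "wp n orc T (Seq (Query 4 (INum 0) 3 (IReg 3)) (Seq (ISet 5 (IReg 3)) (dot_prog 3 6 7))) Q
          (set_reg 4 n (write_block n 4 0 c s3)) t2"
          unfolding s4_def[symmetric]
        proof (rule wp_Seq, rule wp_Query, unfold eq5, rule wp_Seq, rule wp_ISet, unfold eq6,
            rule wp_dot_prog[where chat = chat and d = d and x = p])
          fix t3 assume t3: "t3 \<le> t2 + (T + icost (INum 0) + icost (IReg 3)) + (1 + icost (IReg 3)) + 50 * (n + 1)"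
          show "Q (set_reg 4 n (set_cell 5 7 (dotp n d p) (set_cell 5 6 (dotp n chat p) s6))) t3"
            unfolding s7_def[symmetric]
          proof (rule Q)
            show "t3 \<le> t0 + (T + 200 * (n + 1))" using t1 t2 t3 by simp
          qed (use rep7 p(2) in \<open>simp_all add: defs\<close>)
        qed (use rep4 p(2) in \<open>auto simp: s6_def s5_def rep_def\<close>)
      qed (auto simp: s3_def s2_def s1_def n chat d[unfolded One_nat_def] c_def)
    qed
  qed (use R sp chat d n in auto)
qed

text \<open>The stack top becomes the current point. If registers 1 and 2 stay put, it overwrites
  the old one in the output, which discards that point.\<close>

definition pop_prog :: com where
  "pop_prog =
     Seq (Cond (RLess (RCell 5 (INum 1)) (RCell 5 (INum 8)))
            (Seq (ISet 1 (IAdd (IReg 1) (INum 1))) (ISet 2 (IAdd (IReg 2) (IReg 0))))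
            Skip)
    (Seq (RSet 5 (INum 1) (RCell 5 (INum 8)))
    (Seq (RSet 5 (INum 2) (RCell 5 (INum 4)))
    (Seq (RSet 5 (INum 3) (RCell 5 (INum 5)))
    (Seq (ISet 3 (ISub (IReg 3) (IReg 0)))
         (fill_prog 2 (IReg 2) (RCell 3 (IAdd (IReg 3) (IReg 4))))))))"

lemma wp_pop_prog:
  assumes rep: "rep n chat d m out L mu (R # st) s" and R: "R \<in> extensional {..<n}"
    and cells: "snd s 5 4 = dotp n chat R" "snd s 5 5 = dotp n d R" "snd s 5 8 = l"
    and Q: "\<And>s' t. t \<le> t0 + 100 * (n + 1) \<Longrightarrow>
      rep n chat d m (if mu < l then out @ [L] else out) R l st s' \<Longrightarrow> Q s' t"
  shows "wp n orc T pop_prog Q s t0"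
proof -
  let ?out = "if mu < l then out @ [L] else out"
  \<comment> \<open>The branches differ only in registers 1 and 2, so one postcondition serves both
    and the rest of the program is treated once.\<close>
  define P where "P s' \<longleftrightarrow> fst s' 0 = n \<and> snd s' = snd s \<and> fst s' 1 = Suc (length ?out) \<and>
      fst s' 2 = length ?out * n \<and> fst s' 3 = length (R # st) * n" for s' :: state
  have mu: "snd s 5 1 = mu" using rep by (simp add: rep_def)
  have R3: "read_block n 3 (length st * n) s = R"
    using rep by (simp add: rep_def blocks_append)
  have bl: "blocks n 2 ?out s" "blocks n 3 (rev st) s"
    using rep by (simp_all add: rep_def blocks_append)
  show ?thesis
    unfolding pop_prog_def
  proof (rule wp_Seq, rule wp_conseq[where R = "\<lambda>s' t. P s' \<and> t \<le> t0 + 50"])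
    show "wp n orc T (Cond (RLess (RCell 5 (INum 1)) (RCell 5 (INum 8)))
            (Seq (ISet 1 (IAdd (IReg 1) (INum 1))) (ISet 2 (IAdd (IReg 2) (IReg 0))))
            Skip) (\<lambda>s' t. P s' \<and> t \<le> t0 + 50) s t0"
    proof (rule wp_Cond)
      assume "bval s (RLess (RCell 5 (INum 1)) (RCell 5 (INum 8)))"
      then have "mu < l" using mu cells(3) by simp
      then show "wp n orc T (Seq (ISet 1 (IAdd (IReg 1) (INum 1))) (ISet 2 (IAdd (IReg 2) (IReg 0))))
          (\<lambda>s' t. P s' \<and> t \<le> t0 + 50) s
          (t0 + (1 + bcost (RLess (RCell 5 (INum 1)) (RCell 5 (INum 8)))))"
        using rep by (intro wp_Seq wp_ISet) (simp add: P_def rep_def)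
    next
      assume "\<not> bval s (RLess (RCell 5 (INum 1)) (RCell 5 (INum 8)))"
      then have "\<not> mu < l" using mu cells(3) by simp
      then show "wp n orc T Skip (\<lambda>s' t. P s' \<and> t \<le> t0 + 50) s
          (t0 + (1 + bcost (RLess (RCell 5 (INum 1)) (RCell 5 (INum 8)))))"
        using rep by (intro wp_Skip) (simp add: P_def rep_def)
    qed
  next
    fix s1 t1 assume "P s1 \<and> t1 \<le> t0 + 50"
    then have P: "fst s1 0 = n" "snd s1 = snd s" "fst s1 1 = Suc (length ?out)"
        "fst s1 2 = length ?out * n" "fst s1 3 = length (R # st) * n" and t1: "t1 \<le> t0 + 50"
      by (simp_all only: P_def)
    define s2 where "s2 = set_reg 3 (length st * n) (set_cell 5 3 (dotp n d R)
      (set_cell 5 2 (dotp n chat R) (set_cell 5 1 l s1)))"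
    have eq2: "set_reg 3 (length st * n)
         (set_cell 5 3 (dotp n d R) (set_cell 5 2 (dotp n chat R) (set_cell 5 1 l s1))) = s2"
      by (simp add: s2_def)
    have rb: "read_block n a i s1 = read_block n a i s" for a i
      by (simp add: read_block_def P(2))
    have blk: "blocks n a xs s1 = blocks n a xs s" for a xs
      by (simp add: blocks_def rb)
    have R2: "read_block n 3 (length st * n) s2 = R" by (simp add: s2_def rb R3)
    have fill: "wp n orc T (fill_prog 2 (IReg 2) (RCell 3 (IAdd (IReg 3) (IReg 4)))) Q s2 t2"
      if t2: "t2 \<le> t0 + 80" for t2
    proof (rule wp_fill_prog[where x = R and j = "length ?out * n"])
      show "rval (set_reg 4 i (write_block i 2 (length ?out * n) R s2)) (RCell 3 (IAdd (IReg 3) (IReg 4))) = R i"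
        if "i < n" for i
        using fun_cong[OF R2, of i] that by (simp add: read_block_def s2_def)
      fix t assume t: "t \<le> t2 + (2 + (n + 1) * (icost (IReg 2) + rcost (RCell 3 (IAdd (IReg 3) (IReg 4))) + 11))"
      show "Q (set_reg 4 n (write_block n 2 (length ?out * n) R s2)) t"
      proof (rule Q)
        show "t \<le> t0 + 100 * (n + 1)" using t t2 by simp
        have "blocks n 2 (?out @ [R]) (write_block n 2 (length ?out * n) R s2)"
          unfolding blocks_append
          using R bl(1) by (intro conjI blocks_write_block_above) (simp_all add: s2_def blk)
        then show "rep n chat d m ?out R l st (set_reg 4 n (write_block n 2 (length ?out * n) R s2))"
          using rep bl(2) P by (simp add: rep_def s2_def blk)
      qed
    qed (use P in \<open>simp_all add: s2_def\<close>)
    show "wp n orc T (Seq (RSet 5 (INum 1) (RCell 5 (INum 8)))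
        (Seq (RSet 5 (INum 2) (RCell 5 (INum 4)))
        (Seq (RSet 5 (INum 3) (RCell 5 (INum 5)))
        (Seq (ISet 3 (ISub (IReg 3) (IReg 0)))
             (fill_prog 2 (IReg 2) (RCell 3 (IAdd (IReg 3) (IReg 4)))))))) Q s1 t1"
      by (rule wp_Seq, rule wp_RSet, rule wp_Seq, rule wp_RSet, rule wp_Seq, rule wp_RSet,
          rule wp_Seq, rule wp_ISet)
        (use cells P t1 in \<open>simp add: eq2[unfolded One_nat_def] fill\<close>)
  qed
qed

text \<open>After a successful query the answer already lies above the stack, so pushing it means
  moving register 3.\<close>

definition search_prog :: com where
  "search_prog = While (RLess (RCell 5 (INum 0)) (RCell 5 (INum 3)))
     (Seq query_prog
       (Cond (RLess (RAdd (RCell 5 (INum 6)) (RMul (RCell 5 (INum 8)) (RCell 5 (INum 7))))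
                    (RAdd (RCell 5 (INum 2)) (RMul (RCell 5 (INum 8)) (RCell 5 (INum 3)))))
         (ISet 3 (IAdd (IReg 3) (IReg 0)))
         pop_prog))"

definition init_prog :: com where
  "init_prog =
     Seq (Query 0 (INum 0) 2 (INum 0))
    (Seq (Query 1 (INum 0) 3 (INum 0))
    (Seq (ISet 1 (INum 1))
    (Seq (ISet 2 (INum 0))
    (Seq (ISet 3 (IReg 0))
    (Seq (ISet 5 (INum 0))
    (Seq (dot_prog 3 4 5)
    (Seq (RSet 5 (INum 0) (RCell 5 (INum 5)))
    (Seq (RSet 5 (INum 1) (RNum 0))
         (dot_prog 2 2 3)))))))))"

text \<open>A weighted sum with nonnegative weight is itself a linear objective with nonnegative
  costs, so one nominal query optimises it.\<close>

lemma nominal_solver_wopt: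
  assumes orc: "nominal_solver n X orc"
    and chat: "chat \<in> {..<n} \<rightarrow>\<^sub>E {0..}" and d: "d \<in> {..<n} \<rightarrow>\<^sub>E {0..}" and l: "0 \<le> l"
  shows "wopt X (dotp n chat) (dotp n d) l (orc (\<lambda>i\<in>{..<n}. chat i + l * d i))"
proof -
  let ?c = "\<lambda>i\<in>{..<n}. chat i + l * d i"
  have "?c \<in> {..<n} \<rightarrow>\<^sub>E {0..}" using chat d l by (auto simp: PiE_iff)
  then have "is_arg_min (dotp n ?c) (\<lambda>x. x \<in> X) (orc ?c)"
    using orc unfolding nominal_solver_def by blast
  moreover have "dotp n ?c x = dotp n chat x + l * dotp n d x" for x
    by (simp add: dotp_def algebra_simps sum.distrib sum_distrib_left)
  ultimately show ?thesis by (auto simp: is_arg_min_linorder wopt_def)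
qed

lemma wp_init_prog:
  assumes s: "holds_input n chat d s" and chat: "chat \<in> {..<n} \<rightarrow>\<^sub>E {0..}" and d: "d \<in> {..<n} \<rightarrow>\<^sub>E {0..}"
    and ab: "orc chat \<in> extensional {..<n}" "orc d \<in> extensional {..<n}"
    and Q: "\<And>s' t. t \<le> t0 + (2 * T + 150 * (n + 1)) \<Longrightarrow>
      rep n chat d (dotp n d (orc d)) [] (orc chat) 0 [orc d] s' \<Longrightarrow> Q s' t"
  shows "wp n orc T init_prog Q s t0"
proof -
  have n: "fst s 0 = n" and ca: "\<And>i. i < n \<Longrightarrow> snd s 0 i = chat i"
    and da: "\<And>i. i < n \<Longrightarrow> snd s 1 i = d i"
    using s by (auto simp: holds_input_def)
  define s1 where "s1 = write_block n 2 0 (orc chat) s"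
  define s2 where "s2 = write_block n 3 0 (orc d) s1"
  define s3 where "s3 = set_reg 5 0 (set_reg 3 n (set_reg 2 0 (set_reg 1 1 s2)))"
  define s4 where "s4 = set_reg 4 n (set_cell 5 5 (dotp n d (orc d)) (set_cell 5 4 (dotp n chat (orc d)) s3))"
  define s5 where "s5 = set_cell 5 1 0 (set_cell 5 0 (dotp n d (orc d)) s4)"
  define s6 where "s6 = set_reg 4 n (set_cell 5 3 (dotp n d (orc chat)) (set_cell 5 2 (dotp n chat (orc chat)) s5))"
  note defs = s1_def s2_def s3_def s4_def s5_def s6_def
  have rb: "read_block n 0 0 s = chat" "read_block n 1 0 s1 = d"
    using ca da chat d by (auto simp: read_block_def s1_def fun_eq_iff PiE_iff extensional_def)
  have eq1: "write_block n 2 (ival s (INum 0)) (orc (read_block n 0 (ival s (INum 0)) s)) s = s1"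
    by (simp add: s1_def rb)
  have eq2: "write_block n 3 (ival s1 (INum 0)) (orc (read_block n 1 (ival s1 (INum 0)) s1)) s1 = s2"
    by (simp add: s2_def rb[unfolded One_nat_def])
  show ?thesis
    unfolding init_prog_def
  proof (rule wp_Seq, rule wp_Query, unfold eq1, rule wp_Seq, rule wp_Query, unfold eq2,
      rule wp_Seq, rule wp_ISet, rule wp_Seq, rule wp_ISet, rule wp_Seq, rule wp_ISet,
      rule wp_Seq, rule wp_ISet, goal_cases)
    case 1
    define t1 where "t1 = t0 + (T + icost (INum 0) + icost (INum 0)) + (T + icost (INum 0) + icost (INum 0))
      + (1 + icost (INum 1)) + (1 + icost (INum 0)) + (1 + icost (IReg 0)) + (1 + icost (INum 0))"
    have "wp n orc T (Seq (dot_prog 3 4 5) (Seq (RSet 5 (INum 0) (RCell 5 (INum 5)))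
      (Seq (RSet 5 (INum 1) (RNum 0)) (dot_prog 2 2 3)))) Q s3 t1"
    proof (rule wp_Seq, rule wp_dot_prog[where chat = chat and d = d and x = "orc d"])
      fix t2 assume t2: "t2 \<le> t1 + 50 * (n + 1)"
      have eq5: "set_cell 5 (ival (set_cell 5 (ival s4 (INum 0)) (rval s4 (RCell 5 (INum 5))) s4) (INum 1))
          (rval (set_cell 5 (ival s4 (INum 0)) (rval s4 (RCell 5 (INum 5))) s4) (RNum 0))
          (set_cell 5 (ival s4 (INum 0)) (rval s4 (RCell 5 (INum 5))) s4) = s5"
        by (simp add: s5_def s4_def)
      show "wp n orc T (Seq (RSet 5 (INum 0) (RCell 5 (INum 5)))
          (Seq (RSet 5 (INum 1) (RNum 0)) (dot_prog 2 2 3))) Q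
          (set_reg 4 n (set_cell 5 5 (dotp n d (orc d)) (set_cell 5 4 (dotp n chat (orc d)) s3))) t2"
        unfolding s4_def[symmetric]
      proof (rule wp_Seq, rule wp_RSet, rule wp_Seq, rule wp_RSet, unfold eq5,
          rule wp_dot_prog[where chat = chat and d = d and x = "orc chat"])
        fix t3 assume t3: "t3 \<le> t2 + (1 + icost (INum 0) + rcost (RCell 5 (INum 5))) +
            (1 + icost (INum 1) + rcost (RNum 0)) + 50 * (n + 1)"
        show "Q (set_reg 4 n (set_cell 5 3 (dotp n d (orc chat)) (set_cell 5 2 (dotp n chat (orc chat)) s5))) t3"
          unfolding s6_def[symmetric]
        proof (rule Q)
          show "t3 \<le> t0 + (2 * T + 150 * (n + 1))" using t2 t3 by (simp add: t1_def)
          have bl: "blocks n 2 [orc chat] s6" "blocks n 3 [orc d] s6"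
            using ab by (simp_all add: defs blocks_def)
          then show "rep n chat d (dotp n d (orc d)) [] (orc chat) 0 [orc d] s6"
            by (simp add: rep_def) (simp add: defs n ca da[unfolded One_nat_def])
        qed
      qed (use n ca da[unfolded One_nat_def] ab in \<open>simp_all add: defs\<close>)
    qed (use n ca da[unfolded One_nat_def] ab in \<open>simp_all add: defs\<close>)
    then show ?case by (simp add: t1_def s3_def s2_def s1_def n)
  qed
qed

text \<open>The potential is twice the number of successful queries still possible plus the stack
  height. A push lowers the first part by 2 and adds 1 to the height; a pop removes 1 from the
  height.\<close>

lemma wp_search_prog:
  assumes X: "X \<subseteq> extensional {..<n}"
    and orc: "\<And>l. 0 \<le> l \<Longrightarrow> wopt X f g l (orc (\<lambda>i\<in>{..<n}. chat i + l * d i))"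
    and fg: "f = dotp n chat" "g = dotp n d"
    and H: "\<And>out L mu st H. search_inv X f g m out L mu st H \<Longrightarrow> card H \<le> N"
    and init: "rep n chat d m out0 L0 mu0 st0 s" "search_inv X f g m out0 L0 mu0 st0 H0"
    and Q: "\<And>s' t out L mu st H. t \<le> t0 + (2 * N + length st0 + 1) * (T + 400 * (n + 1)) \<Longrightarrow>
      rep n chat d m out L mu st s' \<Longrightarrow> search_inv X f g m out L mu st H \<Longrightarrow> \<not> m < g L \<Longrightarrow> Q s' t"
  shows "wp n orc T search_prog Q s t0"
  unfolding search_prog_def
proof (rule wp_While[where c = "T + 350 * (n + 1)"
      and I = "\<lambda>k s. \<exists>out L mu st H. rep n chat d m out L mu st s \<and> search_inv X f g m out L mu st H \<and>
        k = 2 * (N - card H) + length st"])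
  show "\<exists>out L mu st H. rep n chat d m out L mu st s \<and> search_inv X f g m out L mu st H \<and>
      2 * (N - card H0) + length st0 = 2 * (N - card H) + length st"
    using init by blast
next
  let ?b = "RLess (RCell 5 (INum 0)) (RCell 5 (INum 3))"
  fix k s' t
  assume "\<exists>out L mu st H. rep n chat d m out L mu st s' \<and> search_inv X f g m out L mu st H \<and>
      k = 2 * (N - card H) + length st"
    and b: "\<not> bval s' ?b"
    and t: "t \<le> t0 + (2 * N + length st0 + 1) * (T + 400 * (n + 1))"
  then obtain out L mu st H where r: "rep n chat d m out L mu st s'" and i: "search_inv X f g m out L mu st H"
    by blast
  have "\<not> m < g L" using r b by (simp add: rep_def fg)
  then show "Q s' t" using Q[OF t r i] by blast
next
  let ?b = "RLess (RCell 5 (INum 0)) (RCell 5 (INum 3))"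
  show "t0 + (2 * (N - card H0) + length st0 + 1) * (1 + bcost ?b + (T + 350 * (n + 1)))
      \<le> t0 + (2 * N + length st0 + 1) * (T + 400 * (n + 1))"
    by (intro add_left_mono mult_le_mono) simp_all
next
  let ?b = "RLess (RCell 5 (INum 0)) (RCell 5 (INum 3))"
  let ?b' = "RLess (RAdd (RCell 5 (INum 6)) (RMul (RCell 5 (INum 8)) (RCell 5 (INum 7))))
                    (RAdd (RCell 5 (INum 2)) (RMul (RCell 5 (INum 8)) (RCell 5 (INum 3))))"
  let ?I = "\<lambda>k s. \<exists>out L mu st H. rep n chat d m out L mu st s \<and> search_inv X f g m out L mu st H \<and>
        k = 2 * (N - card H) + length st"
  fix k s' t
  assume "?I k s'" and b: "bval s' ?b"
  then obtain out L mu st' H where r': "rep n chat d m out L mu st' s'"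
    and i': "search_inv X f g m out L mu st' H" and k': "k = 2 * (N - card H) + length st'"
    by blast
  have m: "m < g L" using r' b by (simp add: rep_def fg)
  obtain R st where st: "st' = R # st" and R: "R \<in> X"
    and mu: "mu \<le> (f R - f L) / (g L - g R)"
    using search_inv_step[OF i', OF m] by metis
  define l where "l = (f R - f L) / (g L - g R)"
  define p where "p = orc (\<lambda>i\<in>{..<n}. chat i + l * d i)"
  note r = r'[unfolded st] and i = i'[unfolded st] and k = k'[unfolded st]
  have "0 \<le> mu" using i by (simp add: search_inv_def)
  then have p: "wopt X f g l p" unfolding p_def using mu by (intro orc) (simp add: l_def)
  have ext: "p \<in> extensional {..<n}" "R \<in> extensional {..<n}" using wopt_in[OF p] R X by auto
  show "wp n orc T (Seq query_prog (Cond ?b' (ISet 3 (IAdd (IReg 3) (IReg 0))) pop_prog))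
      (\<lambda>s' t'. t' \<le> t + (T + 350 * (n + 1)) \<and> (\<exists>k'<k. ?I k' s')) s' t"
  proof (rule wp_Seq, rule wp_query_prog[where orc = orc and p = p, OF r l_def[unfolded fg] p_def ext(1)])
    fix s1 t1
    assume t1: "t1 \<le> t + (T + 200 * (n + 1))" and r1: "rep n chat d m out L mu (R # st) s1"
      and p1: "read_block n 3 (length (R # st) * n) s1 = p"
      and cells: "snd s1 5 4 = dotp n chat R" "snd s1 5 5 = dotp n d R"
        "snd s1 5 6 = dotp n chat p" "snd s1 5 7 = dotp n d p" "snd s1 5 8 = l"
    have cond: "bval s1 ?b' \<longleftrightarrow> f p + l * g p < f L + l * g L"
      using r1 cells by (simp add: rep_def fg)
    show "wp n orc T (Cond ?b' (ISet 3 (IAdd (IReg 3) (IReg 0))) pop_prog)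
      (\<lambda>s' t'. t' \<le> t + (T + 350 * (n + 1)) \<and> (\<exists>k'<k. ?I k' s')) s1 t1"
    proof (rule wp_Cond)
      assume "bval s1 ?b'"
      then have "f p + l * g p < f L + l * g L" using cond by simp
      note push = search_inv_push[OF i, OF m l_def p this]
      have "finite H" using i by (simp add: search_inv_def)
      then have card: "card (insert (p, l) H) = Suc (card H)" using push(2) by simp
      \<comment> \<open>Subtraction is truncated, so the potential drops only because the enlarged
        \<open>H\<close> still obeys the bound \<open>N\<close>.\<close>
      then have le: "Suc (card H) \<le> N" using H[OF push(1)] by simp
      have bl: "blocks n 3 (rev (R # st) @ [p]) s1"
        unfolding blocks_append using r1 p1 by (simp add: rep_def)
      let ?s = "set_reg 3 (ival s1 (IAdd (IReg 3) (IReg 0))) s1"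
      have "rep n chat d m out L mu (p # R # st) ?s"
        using r1 bl by (simp add: rep_def)
      moreover have "2 * (N - card (insert (p, l) H)) + length (p # R # st) < k"
        using le by (simp add: k card)
      ultimately have "\<exists>k'<k. ?I k' ?s" using push(1) by blast
      then show "wp n orc T (ISet 3 (IAdd (IReg 3) (IReg 0)))
          (\<lambda>s' t'. t' \<le> t + (T + 350 * (n + 1)) \<and> (\<exists>k'<k. ?I k' s')) s1 (t1 + (1 + bcost ?b'))"
        using t1 by (intro wp_ISet conjI) simp_all
    next
      assume "\<not> bval s1 ?b'"
      then have "f L + l * g L \<le> f p + l * g p" using cond by simp
      note pop = search_inv_pop[OF i, OF m l_def p this]
      have "2 * (N - card H) + length st < k" by (simp add: k)
      then show "wp n orc T pop_prog
          (\<lambda>s' t'. t' \<le> t + (T + 350 * (n + 1)) \<and> (\<exists>k'<k. ?I k' s')) s1 (t1 + (1 + bcost ?b'))"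
        using pop t1
        by (intro wp_pop_prog[OF r1 ext(2) cells(1,2,5)] conjI) (simp, blast)
    qed
  qed
qed

section \<open>Total running time and size of the output\<close>

theorem theorem7:
  shows "\<exists>(P :: com) (C :: nat).
    \<forall>(n :: nat) (X :: vect set) (chat :: vect) (d :: vect) (E :: vect set) (K :: nat)
      (orc :: vect \<Rightarrow> vect) (T :: nat) (s :: state).
      X \<noteq> {} \<and> X \<subseteq> {..<n} \<rightarrow>\<^sub>E {0, 1} \<and>
      chat \<in> {..<n} \<rightarrow>\<^sub>E {0..} \<and> d \<in> {..<n} \<rightarrow>\<^sub>E {0..} \<and>
      is_E_min n X chat d E \<and> card E \<le> K \<and>
      nominal_solver n X orc \<and> 1 \<le> T \<and> n \<le> T \<and>
      holds_input n chat d s \<longrightarrow>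
      (\<exists>t s' S. exec n orc T P s t s' \<and> t \<le> C * (K * T) \<and>
         holds_output n S s' \<and>
         variable_sized_solution n X chat (box_set n d) S \<and> card S \<le> K)"
proof (rule exI[of _ "Seq init_prog search_prog"], rule exI[of _ 10000], intro allI impI, elim conjE)
  fix n X chat d E K orc T s
  assume X0: "X \<noteq> {}" and X: "X \<subseteq> {..<n} \<rightarrow>\<^sub>E {0, 1}"
    and chat: "chat \<in> {..<n} \<rightarrow>\<^sub>E {0..}" and d: "d \<in> {..<n} \<rightarrow>\<^sub>E {0..}"
    and E: "is_E_min n X chat d E" and K: "card E \<le> K"
    and orc: "nominal_solver n X orc" and T: "1 \<le> T" "n \<le> T"
    and s: "holds_input n chat d s"
  let ?f = "dotp n chat" and ?g = "dotp n d"
  have finX: "finite X" using X by (rule finite_subset) (simp add: finite_PiE)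
  have extX: "X \<subseteq> extensional {..<n}" using X by (auto simp: PiE_def)
  have "E \<subseteq> X" using E by (auto simp: is_E_min_def efficient_extreme_def)
  then have finE: "finite E" using finX by (rule finite_subset)
  note EX = E_min_wopt_max[OF E finX X0]
  \<comment> \<open>This gives \<open>1 \<le> K\<close>, so that the time of the initialisation is
    absorbed by \<open>K * T\<close>.\<close>
  have "E \<noteq> {}" using EX[of 1] by auto
  then have E1: "1 \<le> card E" using finE by (simp add: Suc_le_eq card_gt_0_iff)
  note nominal = nominal_solver_wopt[OF orc chat d]
  have "(\<lambda>i\<in>{..<n}. chat i + 0 * d i) = chat"
    using chat by (simp add: PiE_def extensional_restrict)
  then have a: "wopt X ?f ?g 0 (orc chat)" using nominal[of 0] by simp
  have "is_arg_min ?g (\<lambda>x. x \<in> X) (orc d)" using orc d unfolding nominal_solver_def by blast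
  then have b: "orc d \<in> X" "\<And>y. y \<in> X \<Longrightarrow> ?g (orc d) \<le> ?g y"
    by (auto simp: is_arg_min_linorder)
  have cardH: "card H \<le> 2 * card E"
    if "search_inv X ?f ?g m out L mu st H" for m out L mu st H
  proof (rule card_witnesses_le[OF _ _ _ finE])
    show "\<exists>e\<in>E. wopt_max X ?f ?g l e" if "(p, l) \<in> H" for p l
      using EX \<open>search_inv X ?f ?g m out L mu st H\<close> that by (auto simp: search_inv_def)
  qed (use that in \<open>auto simp: search_inv_def\<close>)
  let ?Q = "\<lambda>s' t. t \<le> 10000 * (K * T) \<and> (\<exists>S. holds_output n S s' \<and>
      variable_sized_solution n X chat (box_set n d) S \<and> card S \<le> K)"
  have "wp n orc T (Seq init_prog search_prog) ?Q s 0"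
  proof (rule wp_Seq, rule wp_init_prog[OF s chat d])
    show "orc chat \<in> extensional {..<n}" "orc d \<in> extensional {..<n}"
      using extX wopt_in[OF a] b(1) by auto
    fix s1 t1
    assume t1: "t1 \<le> 0 + (2 * T + 150 * (n + 1))"
      and r1: "rep n chat d (?g (orc d)) [] (orc chat) 0 [orc d] s1"
    have init: "search_inv X ?f ?g (?g (orc d)) [] (orc chat) 0 [orc d] {}"
      by (rule search_inv_init[where g = ?g, OF a b(1)]) (rule b(2))
    show "wp n orc T search_prog ?Q s1 t1"
    proof (rule wp_search_prog[where N = "2 * card E", OF extX _ refl refl _ r1 init])
      show "wopt X ?f ?g l (orc (\<lambda>i\<in>{..<n}. chat i + l * d i))" if "0 \<le> l" for l
        using that by (rule nominal)
      show "card H \<le> 2 * card E" if "search_inv X ?f ?g (?g (orc d)) out L mu st H" for out L mu st H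
        using that by (rule cardH)
    next
      fix s2 t out L mu st H
      assume t: "t \<le> t1 + (2 * (2 * card E) + length [orc d] + 1) * (T + 400 * (n + 1))"
        and r: "rep n chat d (?g (orc d)) out L mu st s2"
        and i: "search_inv X ?f ?g (?g (orc d)) out L mu st H" and L: "\<not> ?g (orc d) < ?g L"
      note fin = search_inv_final[OF i, OF L]
      let ?xs = "out @ [L]"
      \<comment> \<open>The linear work per query is thus at most \<open>800 * T\<close>. There are
        at most \<open>4 * card E + 2\<close> units of \<open>T + 400 * (n + 1)\<close>, whence the
        factor \<open>6 * K\<close>; initialisation adds at most \<open>302 * T\<close>.\<close>
      have n1: "n + 1 \<le> 2 * T" using T by simp
      have "(2 * (2 * card E) + length [orc d] + 1) * (T + 400 * (n + 1)) \<le> (6 * K) * (801 * T)"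
        using E1 K n1 by (intro mult_le_mono) simp_all
      moreover have "T \<le> K * T" using E1 K by simp
      ultimately have time: "t \<le> 10000 * (K * T)" using t t1 n1 by simp
      have "bij_betw (\<lambda>k. ?xs ! k) {..<length ?xs} (set ?xs)"
        by (rule bij_betw_nth[OF fin(4)]) auto
      moreover have "read_block n 2 (k * n) s2 = ?xs ! k" if "k < length ?xs" for k
        using r that by (simp add: rep_def blocks_def)
      ultimately have "bij_betw (\<lambda>k. read_block n 2 (k * n) s2) {..<length ?xs} (set ?xs)"
        by (subst bij_betw_cong[where g = "\<lambda>k. ?xs ! k"]) auto
      then have out: "holds_output n (set ?xs) s2"
        using r by (simp add: holds_output_def rep_def)
      have sol: "variable_sized_solution n X chat (box_set n d) (set ?xs)"
        by (rule variable_sized_solutionI[OF X d fin(5,2,3,1)])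
      \<comment> \<open>\<open>E\<close> contains an optimal solution for every positive weight, so
        it bounds the pinned points just as any cover does.\<close>
      have "card (set ?xs) \<le> card E"
        using fin(2)
      proof (rule card_pinned_le[OF _ fin(3) finE])
        show "\<exists>x\<in>E. wopt X ?f ?g l x" if "0 < l" for l
          using EX[OF that] by (auto simp: wopt_max_def)
      qed
      then show "?Q s2 t" using time out sol K by (meson le_trans)
    qed
  qed
  then show "\<exists>t s' S. exec n orc T (Seq init_prog search_prog) s t s' \<and> t \<le> 10000 * (K * T) \<and>
      holds_output n S s' \<and> variable_sized_solution n X chat (box_set n d) S \<and> card S \<le> K"
    unfolding wp_def by auto
qed

end
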